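(* (a) Let $\mathcal{F}$ be a consistent family of encodings of a nested family of Hilbert spaces $\{\mathcal{H}^{E_i}\}$, and $\Psi=\{|\psi_i\rangle\}$ with $|\psi_i\rangle\in\mathcal{H}^{E_i}$. Then $\Psi$ is an encoded universal resource with respect to $\mathcal{F}$ up to logical Pauli operators if and only if, for every $d$, an encoded (with respect to $\mathcal{F}$) 2D cluster state $|\mathbf{C}_{d\times d}\rangle$ can be generated from some member of $\Psi$ by LOCC up to logical Pauli operations. (b) $\Psi$ is an encoded universal resource up to logical Pauli operators if and only if there exists a consistent family of encodings such that encoded 2D cluster states $|\mathbf{C}_{d\times d}\rangle$ of arbitrary $d$ can be generated from $\Psi$ by LOCC up to logical Pauli operations.
   Context: An $m$-qubit encoding of an $n$-qubit system consists of a set $E$ of $mn$ qubits, a partition $\mathcal{P}=\{A_1,\dots,A_n\}$ of $E$ into blocks of $m$ qubits, and two fixed orthogonal $m$-qubit states $|\mathbf0\rangle,|\mathbf1\rangle$; the encoded version of $|\phi\rangle=\sum c_{i_1\dots i_n}|i_1\dots i_n\rangle$ is $|\boldsymbol\phi\rangle=\sum c_{i_1\dots i_n}|\mathbf{i}_1\rangle_{A_1}\cdots|\mathbf{i}_n\rangle_{A_n}$, and for a one-qubit operator $U=\sum_{a,b}u_{ab}|a\rangle\langle b|$ its logical version is $\mathbf U=\sum_{a,b}u_{ab}|\mathbf a\rangle\langle\mathbf b|$, acting on a block. A nested family of Hilbert spaces is $\{\mathcal H^{E_i}\}$ with $E_i$ a finite set of qubits and $E_i\subseteq E_{i+1}$.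 A consistent family of encodings is $\mathcal F=\{\mathcal E_1,\mathcal E_2,\dots\}$, $\mathcal E_i$ an $m$-qubit encoding of $\mathcal H^{E_i}$ (fixed $m$ and fixed $|\mathbf0\rangle,|\mathbf1\rangle$) with partition $\mathcal P_i$ of $E_i$ into blocks, such that $\mathcal P_i\subseteq\mathcal P_{i+1}$. "Generated by LOCC up to logical Pauli operations": starting from $|\psi_i\rangle$, an LOCC protocol on the physical qubits (each physical qubit a party) exactly and with probability one yields, on a fixed set of $n$ blocks of $\mathcal P_i$, the state $(\mathbf P_1\otimes\cdots\otimes\mathbf P_n)|\boldsymbol\phi\rangle$ where each $\mathbf P_k$ is a logical Pauli operator ($\mathbf 1,\boldsymbol\sigma_x,\boldsymbol\sigma_y,\boldsymbol\sigma_z$) possibly depending on the branch, the remaining qubits being in $|0\rangle$. $\Psi$ is encoded universal w.r.t. $\mathcal F$ up to logical Pauli operators if every $n$-qubit $|\phi\rangle$ (every $n$) can be so generated from some $|\psi_i\rangle$ (encoded w.r.t. $\mathcal E_i$). The 2D cluster state $|C_{d\times d}\rangle$ is the graph state (joint $+1$ eigenstate of $\sigma_x^{(a)}\prod_{b\sim a}\sigma_z^{(b)}$) of the $d\times d$ grid graph. *)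

theory Defs
  imports Complex_Main
begin

text \<open>A (pure, unnormalised) state of a set of qubits with labels of type 'a is a function
  from computational basis configurations to amplitudes.  A basis configuration is the set
  of qubits that are in state 1.  A state of the finite qubit set E is supported on Pow E.
  Logical (abstract) n-qubit states use qubit labels 0..n-1 (type nat).\<close>

type_synonym 'a qvec = "'a set \<Rightarrow> complex"
type_synonym op1 = "bool \<Rightarrow> bool \<Rightarrow> complex"  \<comment> \<open>one-qubit operator, entry (row, column)\<close>

definition supported :: "'a set \<Rightarrow> 'a qvec \<Rightarrow> bool" where
  "supported E v \<longleftrightarrow> (\<forall>S. \<not> S \<subseteq> E \<longrightarrow> v S = 0)"

definition qinner :: "'a set \<Rightarrow> 'a qvec \<Rightarrow> 'a qvec \<Rightarrow> complex" where
  "qinner E u v = (\<Sum>S\<in>Pow E. cnj (u S) * v S)"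

definition is_state :: "'a set \<Rightarrow> 'a qvec \<Rightarrow> bool" where
  "is_state E v \<longleftrightarrow> finite E \<and> supported E v \<and> (\<Sum>S\<in>Pow E. (cmod (v S))^2) = 1"

definition apply1 :: "op1 \<Rightarrow> 'a \<Rightarrow> 'a qvec \<Rightarrow> 'a qvec" where
  "apply1 U a v = (\<lambda>S. U (a \<in> S) False * v (S - {a}) + U (a \<in> S) True * v (insert a S))"

fun apply_ops :: "(nat \<Rightarrow> op1) \<Rightarrow> nat \<Rightarrow> nat qvec \<Rightarrow> nat qvec" where
  "apply_ops U 0 v = v"
| "apply_ops U (Suc n) v = apply1 (U n) n (apply_ops U n v)"

definition pauli_I :: op1 where "pauli_I a b = (if a = b then 1 else 0)"
definition pauli_X :: op1 where "pauli_X a b = (if a \<noteq> b then 1 else 0)"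
definition pauli_Y :: op1 where "pauli_Y a b = (if a = b then 0 else if a then \<i> else - \<i>)"
definition pauli_Z :: op1 where "pauli_Z a b = (if a = b then (if a then -1 else 1) else 0)"

definition paulis :: "op1 set" where "paulis = {pauli_I, pauli_X, pauli_Y, pauli_Z}"

text \<open>Product of sigma_z on all qubits of N (they commute).\<close>
definition apply_Zs :: "'a set \<Rightarrow> 'a qvec \<Rightarrow> 'a qvec" where
  "apply_Zs N v = (\<lambda>S. (-1) ^ card (N \<inter> S) * v S)"

text \<open>A (finite-round) LOCC protocol is a tree: at each node one party (qubit a) performs a
  local instrument given by a list of Kraus operators on its qubit and broadcasts the outcome;
  the remaining protocol may depend on all outcomes so far.\<close>

datatype 'q locc = Stop | Meas 'q "(op1 \<times> 'q locc) list"

definition kraus_complete :: "op1 list \<Rightarrow> bool" where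
  "kraus_complete Ks \<longleftrightarrow>
     (\<forall>b b'. (\<Sum>K\<leftarrow>Ks. \<Sum>a\<in>UNIV. cnj (K a b) * K a b') = (if b = b' then 1 else 0))"

inductive locc_wf :: "'q set \<Rightarrow> 'q locc \<Rightarrow> bool" for E where
  "locc_wf E Stop"
| "a \<in> E \<Longrightarrow> kraus_complete (map fst ks) \<Longrightarrow> (\<forall>p\<in>set ks. locc_wf E (snd p))
     \<Longrightarrow> locc_wf E (Meas a ks)"

text \<open>locc_branch pr v w: w is the (unnormalised) final state on some branch of pr applied to v.
  Its squared norm is the probability of that branch.\<close>
inductive locc_branch :: "'q locc \<Rightarrow> 'q qvec \<Rightarrow> 'q qvec \<Rightarrow> bool" where
  "locc_branch Stop v v"
| "(K, pr) \<in> set ks \<Longrightarrow> locc_branch pr (apply1 K a v) w \<Longrightarrow> locc_branch (Meas a ks) v w"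

text \<open>A block of m qubits is a duplicate-free list of length m (giving the order of its qubits,
  so that the m-qubit logical states zL, oL on qubits 0..m-1 can be placed on it).\<close>

definition partition_blocks :: "nat \<Rightarrow> 'q set \<Rightarrow> 'q list set \<Rightarrow> bool" where
  "partition_blocks m E P \<longleftrightarrow>
     (\<forall>b\<in>P. length b = m \<and> distinct b) \<and>
     (\<forall>b\<in>P. \<forall>b'\<in>P. b \<noteq> b' \<longrightarrow> set b \<inter> set b' = {}) \<and>
     \<Union>(set ` P) = E"

definition consistent_family ::
  "(nat \<Rightarrow> 'q set) \<Rightarrow> nat \<Rightarrow> nat qvec \<Rightarrow> nat qvec \<Rightarrow> (nat \<Rightarrow> 'q list set) \<Rightarrow> bool" where
  "consistent_family E m zL oL P \<longleftrightarrow>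
     (\<forall>i. finite (E i) \<and> E i \<subseteq> E (Suc i)) \<and>
     is_state {..<m} zL \<and> is_state {..<m} oL \<and> qinner {..<m} zL oL = 0 \<and>
     (\<forall>i. partition_blocks m (E i) (P i)) \<and> (\<forall>i. P i \<subseteq> P (Suc i))"

text \<open>Encoded version, on the physical qubit set E, of the logical (length bs)-qubit state phi,
  logical qubit k being placed on block bs!k; all other qubits of E are in state 0.\<close>
definition encode ::
  "nat \<Rightarrow> nat qvec \<Rightarrow> nat qvec \<Rightarrow> 'q set \<Rightarrow> 'q list list \<Rightarrow> nat qvec \<Rightarrow> 'q qvec" where
  "encode m zL oL E bs phi = (\<lambda>S.
     if S \<subseteq> E \<and> S \<inter> (E - \<Union>(set ` set bs)) = {} then
       (\<Sum>x\<in>Pow {..<length bs}. phi x *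
          (\<Prod>k<length bs. (if k \<in> x then oL else zL) {j. j < m \<and> bs ! k ! j \<in> S}))
     else 0)"

text \<open>The logical n-qubit state phi is generated from psi i by LOCC up to logical Pauli
  operations: exactly and with probability one, every branch of nonzero probability ends in
  (a multiple of) the encoded version of (P_1 x ... x P_n) phi on a fixed list of n blocks.\<close>
definition generated_LOCC_pauli ::
  "(nat \<Rightarrow> 'q set) \<Rightarrow> nat \<Rightarrow> nat qvec \<Rightarrow> nat qvec \<Rightarrow> (nat \<Rightarrow> 'q list set)
   \<Rightarrow> (nat \<Rightarrow> 'q qvec) \<Rightarrow> nat \<Rightarrow> nat \<Rightarrow> nat qvec \<Rightarrow> bool" where
  "generated_LOCC_pauli E m zL oL P psi i n phi \<longleftrightarrow>
     (\<exists>bs. length bs = n \<and> distinct bs \<and> set bs \<subseteq> P i \<and>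
        (\<exists>pr. locc_wf (E i) pr \<and>
           (\<forall>w. locc_branch pr (psi i) w \<and> w \<noteq> (\<lambda>_. 0) \<longrightarrow>
              (\<exists>ps c. (\<forall>k<n. ps k \<in> paulis) \<and>
                  w = (\<lambda>S. c * encode m zL oL (E i) bs (apply_ops ps n phi) S)))))"

definition encoded_universal ::
  "(nat \<Rightarrow> 'q set) \<Rightarrow> nat \<Rightarrow> nat qvec \<Rightarrow> nat qvec \<Rightarrow> (nat \<Rightarrow> 'q list set)
   \<Rightarrow> (nat \<Rightarrow> 'q qvec) \<Rightarrow> bool" where
  "encoded_universal E m zL oL P psi \<longleftrightarrow>
     (\<forall>n phi. is_state {..<n} phi \<longrightarrow> (\<exists>i. generated_LOCC_pauli E m zL oL P psi i n phi))"

text \<open>Vertex (r, c) of the d x d grid is the logical qubit r * d + c.\<close>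
definition grid_adj :: "nat \<Rightarrow> nat \<Rightarrow> nat \<Rightarrow> bool" where
  "grid_adj d k l \<longleftrightarrow> k < d * d \<and> l < d * d \<and>
     ((k div d = l div d \<and> (k mod d + 1 = l mod d \<or> l mod d + 1 = k mod d)) \<or>
      (k mod d = l mod d \<and> (k div d + 1 = l div d \<or> l div d + 1 = k div d)))"

text \<open>Cluster state: joint +1 eigenstate of all sigma_x^(a) prod_{b ~ a} sigma_z^(b)
  (a normalised such state; it is unique up to a global phase).\<close>
definition is_cluster_state :: "nat \<Rightarrow> nat qvec \<Rightarrow> bool" where
  "is_cluster_state d phi \<longleftrightarrow> is_state {..<d * d} phi \<and>
     (\<forall>a < d * d. apply1 pauli_X a (apply_Zs {b. grid_adj d a b} phi) = phi)"

definition cluster_generable ::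
  "(nat \<Rightarrow> 'q set) \<Rightarrow> nat \<Rightarrow> nat qvec \<Rightarrow> nat qvec \<Rightarrow> (nat \<Rightarrow> 'q list set)
   \<Rightarrow> (nat \<Rightarrow> 'q qvec) \<Rightarrow> bool" where
  "cluster_generable E m zL oL P psi \<longleftrightarrow>
     (\<forall>d. \<exists>phi. is_cluster_state d phi \<and>
        (\<exists>i. generated_LOCC_pauli E m zL oL P psi i (d * d) phi))"

end

theory Submission
  imports Defs "HOL-Combinatorics.Cycles"
begin

text \<open>A universal family generates cluster states because they exist. Conversely, a block can be
  measured destructively in any logical basis by LOCC, since two orthogonal states of several
  qubits are distinguishable by LOCC; so it suffices to prepare an arbitrary state by adaptive
  one-qubit measurements on a large cluster state. Z measurements cut out a grid with \<open>n\<close> rows.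
  Measuring a column in the X basis applies a fixed Clifford map \<open>transfer\<close>, up to Pauli operators, and
  rotating the basis of one of its qubits inserts a Z rotation before it. As \<open>transfer\<close> permutes the
  finitely many Pauli operators up to sign, it has finite order up to a scalar, so its inverse is
  available too and the realised rotations are closed under conjugation with \<open>transfer\<close>. Products of
  anticommuting rotation axes then give all tensor products of \<open>\<sigma>\<^sub>z\<close>, hence all diagonal unitaries, and
  together with one-qubit Hadamard gates these prepare every state qubit by qubit.\<close>

section \<open>Signs, Weyl operators and graph states\<close>

text \<open>All branches must end on the same list of blocks, so no outcome may change how far the
  computation runs: outcomes enter only through a Pauli operator carried along to the end, where the
  notion of generation tolerates it. An X part of that operator reverses the sense of a Z rotation,
  and the only adaptation at the logical level is to conjugate the next phase. Hence
  \<open>reach\<close> counts columns, and the number \<open>L\<close> of columns depends on the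
  target state alone. Vectors are unnormalised and scalars are dropped; angles are arbitrary, so
  synthesis is exact and no approximation argument occurs. Pauli operators are labelled by pairs of
  sets under symmetric difference, because then commutation signs, edge signs and Hadamard kernels
  all come from the one bicharacter \<open>zs\<close>. The game on logical qubits
  (\<open>logically_steerable\<close>) is kept apart from LOCC (\<open>steerable\<close>); the two
  are linked by discriminating states of one block.\<close>

definition sd :: "'a set \<Rightarrow> 'a set \<Rightarrow> 'a set" (infixl "\<ominus>" 65) where
  "A \<ominus> B = (A - B) \<union> (B - A)"

lemma sd_commute: "A \<ominus> B = B \<ominus> A" and sd_assoc: "A \<ominus> B \<ominus> C = A \<ominus> (B \<ominus> C)"
  by (auto simp: sd_def)

lemma sd_simps [simp]: "A \<ominus> A = {}" "A \<ominus> {} = A" "{} \<ominus> A = A" "A \<ominus> (A \<ominus> B) = B"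
  "B \<ominus> A \<ominus> A = B"
  by (auto simp: sd_def)

lemma finite_sd [simp]: "finite A \<Longrightarrow> finite B \<Longrightarrow> finite (A \<ominus> B)"
  by (simp add: sd_def)

lemma sd_subset [simp]: "A \<subseteq> N \<Longrightarrow> S \<ominus> A \<subseteq> N \<longleftrightarrow> S \<subseteq> N"
  by (auto simp: sd_def)

lemma sd_subsetI: "A \<subseteq> N \<Longrightarrow> S \<subseteq> N \<Longrightarrow> S \<ominus> A \<subseteq> N"
  by (auto simp: sd_def)

lemma sd_insert: "a \<notin> S \<Longrightarrow> S \<ominus> {a} = insert a S"
  by (auto simp: sd_def)

lemma sd_disjoint: "A \<inter> B = {} \<Longrightarrow> A \<ominus> B = A \<union> B"
  by (auto simp: sd_def)

lemma image_sd: "inj f \<Longrightarrow> f ` (A \<ominus> B) = f ` A \<ominus> f ` B"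
  by (auto simp: sd_def inj_def)

text \<open>At once the sign for commuting Z on \<open>A\<close> past X on \<open>B\<close>, the
  Hadamard kernel, and a character of the group of finite sets. An infinite intersection has
  \<open>card\<close> 0, hence the finiteness premises of its bilinearity.\<close>

definition zs :: "'a set \<Rightarrow> 'a set \<Rightarrow> complex" where
  "zs A B = (-1) ^ card (A \<inter> B)"

lemma zs_commute: "zs A B = zs B A"
  by (simp add: zs_def Int_commute)

lemma zs_empty [simp]: "zs {} A = 1" "zs A {} = 1"
  by (simp_all add: zs_def)

lemma zs_square [simp]: "zs A B * zs A B = 1"
  by (simp add: zs_def flip: power_add mult_2)

lemma zs_square_left [simp]: "zs A B * (zs A B * z) = z"
  by (simp flip: mult.assoc)

lemma zs_cases: "zs A B = 1 \<or> zs A B = - 1"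
  by (cases "even (card (A \<inter> B))") (auto simp: zs_def)

lemma zs_nonzero [simp]: "zs A B \<noteq> 0"
  by (simp add: zs_def)

lemma zs_singleton: "zs A {a} = (if a \<in> A then -1 else 1)" "zs {a} A = (if a \<in> A then -1 else 1)"
  by (auto simp: zs_def)

lemma zs_disjoint: "A \<inter> B = {} \<Longrightarrow> zs A B = 1"
  by (simp add: zs_def)

lemma zs_Int_right: "A \<subseteq> N \<Longrightarrow> zs (B \<inter> N) A = zs B A"
  by (simp add: zs_def Int_assoc Int_absorb1 Int_absorb2)

lemma zs_sd_right:
  assumes "finite (A \<inter> B)" "finite (A \<inter> C)"
  shows "zs A (B \<ominus> C) = zs A B * zs A C"
proof -
  have fin: "finite (A \<inter> (B - C))" "finite (A \<inter> (C - B))"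
    using assms by (simp_all add: Int_Diff[symmetric])
  have "A \<inter> B - C = A \<inter> (B - C)" "A \<inter> C - B = A \<inter> (C - B)" "A \<inter> C \<inter> B = A \<inter> B \<inter> C"
    by auto
  then have 1: "card (A \<inter> B) = card (A \<inter> B \<inter> C) + card (A \<inter> (B - C))"
    "card (A \<inter> C) = card (A \<inter> B \<inter> C) + card (A \<inter> (C - B))"
    using card_Int_Diff[OF assms(1), of C] card_Int_Diff[OF assms(2), of B] by simp_all
  have 2: "card (A \<inter> (B \<ominus> C)) = card (A \<inter> (B - C)) + card (A \<inter> (C - B))"
    unfolding sd_def Int_Un_distrib by (rule card_Un_disjoint) (use fin in auto)
  show ?thesis
    unfolding zs_def 1 2 power_add
    by (cases "even (card (A \<inter> B \<inter> C))") simp_all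
qed

lemma zs_sd_left:
  "finite (A \<inter> B) \<Longrightarrow> finite (A \<inter> C) \<Longrightarrow> zs (B \<ominus> C) A = zs B A * zs C A"
  by (simp add: zs_sd_right zs_commute[of _ A])

lemma zs_image: "inj f \<Longrightarrow> zs A (f ` B) = zs (f -` A) B"
proof -
  assume "inj f"
  have "A \<inter> f ` B = f ` (f -` A \<inter> B)" by auto
  then have "card (A \<inter> f ` B) = card (f -` A \<inter> B)"
    using \<open>inj f\<close> by (simp add: card_image inj_on_subset[OF _ subset_UNIV])
  then show ?thesis by (simp add: zs_def)
qed

text \<open>The parity of the number of edges \<open>{a, f a}\<close> inside \<open>S\<close>.\<close>

definition edge_sign :: "('a \<Rightarrow> 'a) \<Rightarrow> 'a set \<Rightarrow> complex" where
  "edge_sign f S = zs S (f ` S)"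

lemma edge_sign_square [simp]: "edge_sign f S * edge_sign f S = 1"
  by (simp add: edge_sign_def)

lemma edge_sign_square_left [simp]: "edge_sign f S * (edge_sign f S * z) = z"
  by (simp flip: mult.assoc)

text \<open>\<open>edge_sign f\<close> is a quadratic form over the two-element field. The cross
  terms form its polarisation, the symmetric adjacency relation: image and preimage of
  \<open>A\<close> under \<open>f\<close> together are the neighbours of \<open>A\<close>, counted
  modulo 2.\<close>

lemma edge_sign_sd:
  assumes "inj f" "finite S" "finite A"
  shows "edge_sign f (S \<ominus> A) = edge_sign f S * edge_sign f A * zs (f ` A \<ominus> f -` A) S"
proof -
  have fin: "finite (f -` A)" using assms by (auto intro: finite_vimageI)
  have "edge_sign f (S \<ominus> A) = zs S (f ` S) * zs A (f ` S) * (zs S (f ` A) * zs A (f ` A))"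
    using assms by (simp add: edge_sign_def image_sd zs_sd_right zs_sd_left)
  also have "zs A (f ` S) = zs (f -` A) S" using assms by (simp add: zs_image)
  also have "zs S (f ` A) = zs (f ` A) S" by (rule zs_commute)
  finally show ?thesis
    using assms fin by (simp add: edge_sign_def zs_sd_left)
qed

text \<open>The Pauli operator \<open>Z\<^sub>B X\<^sub>A\<close>.\<close>

definition W :: "'a set \<Rightarrow> 'a set \<Rightarrow> 'a qvec \<Rightarrow> 'a qvec" where
  "W A B v = (\<lambda>S. zs B S * v (S \<ominus> A))"

lemma W_scale: "W A B (\<lambda>S. c * v S) = (\<lambda>S. c * W A B v S)"
  by (auto simp: W_def)

lemma W_add: "W A B (\<lambda>S. u S + v S) = (\<lambda>S. W A B u S + W A B v S)"
  by (auto simp: W_def algebra_simps)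

lemma W_W:
  assumes "finite B" "finite B'" 
  shows "W A B (W A' B' v) = (\<lambda>S. zs B' A * W (A \<ominus> A') (B \<ominus> B') v S)"
  using assms by (simp add: W_def zs_sd_right zs_sd_left sd_assoc mult_ac fun_eq_iff)

lemma W_empty [simp]: "W {} {} v = v"
  by (simp add: W_def)

text \<open>Signs matter only where the vector can be nonzero. This keeps labels inside the finite
  set of pairs of subsets of \<open>N\<close>.\<close>

lemma W_Int:
  assumes "A \<subseteq> N" "supported N u"
  shows "W A (B \<inter> N) u = W A B u"
proof
  fix S show "W A (B \<inter> N) u S = W A B u S"
    using assms by (cases "S \<subseteq> N") (auto simp: W_def zs_Int_right supported_def)
qed

lemma sum_Pow_sd:
  assumes "A \<subseteq> N"
  shows "(\<Sum>x\<in>Pow N. f (x \<ominus> A)) = (\<Sum>x\<in>Pow N. f x)"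
  by (rule sum.reindex_bij_witness[of _ "\<lambda>x. x \<ominus> A" "\<lambda>x. x \<ominus> A"]) (use assms in auto)

text \<open>Orthogonality of characters: toggling one element of \<open>y\<close> negates every
  summand.\<close>

lemma sum_zs:
  assumes "finite N" "y \<subseteq> N"
  shows "(\<Sum>x\<in>Pow N. zs x y) = (if y = {} then 2 ^ card N else 0)"
proof (cases "y = {}")
  case True then show ?thesis using assms by (simp add: card_Pow)
next
  case False
  then obtain a where a: "a \<in> y" by auto
  have "(\<Sum>x\<in>Pow N. zs x y) = (\<Sum>x\<in>Pow N. zs (x \<ominus> {a}) y)"
    by (rule sum_Pow_sd[symmetric]) (use a assms in auto)
  also have "\<dots> = (\<Sum>x\<in>Pow N. - zs x y)"
    using assms finite_subset[OF assms(2,1)] a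
    by (intro sum.cong) (auto simp: zs_sd_left zs_singleton)
  also have "\<dots> = - (\<Sum>x\<in>Pow N. zs x y)" by (simp add: sum_negf)
  finally show ?thesis using False by simp
qed

section \<open>The transfer map of a cluster column\<close>

text \<open>Neighbourhood modulo 2 in the path 0, 1, 2, ... of rows. It can leave \<open>N\<close>
  at the upper end, which is why labels get intersected with \<open>N\<close>.\<close>

definition nb :: "nat set \<Rightarrow> nat set" where
  "nb A = Suc ` A \<ominus> Suc -` A"

lemma finite_nb [simp]: "finite A \<Longrightarrow> finite (nb A)"
  by (simp add: nb_def finite_vimageI)

definition cz :: "nat qvec \<Rightarrow> nat qvec" where
  "cz u = (\<lambda>x. edge_sign Suc x * u x)"

lemma cz_twice [simp]: "cz (cz u) = u"
  by (simp add: cz_def flip: mult.assoc)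

lemma supported_cz [simp]: "supported N (cz u) \<longleftrightarrow> supported N u"
  by (simp add: supported_def cz_def edge_sign_def)

lemma cz_W:
  assumes "finite N" "A \<subseteq> N" "finite B" "supported N u"
  shows "cz (W A B u) = (\<lambda>x. edge_sign Suc A * W A (B \<ominus> nb A) (cz u) x)"
proof
  fix x
  have fin: "finite A" using assms finite_subset by blast
  show "cz (W A B u) x = edge_sign Suc A * W A (B \<ominus> nb A) (cz u) x"
  proof (cases "x \<subseteq> N")
    case True
    then have "finite x" using assms finite_subset by blast
    then have "edge_sign Suc (x \<ominus> A) = edge_sign Suc x * edge_sign Suc A * zs (nb A) x"
      using fin by (simp add: edge_sign_sd nb_def)
    then show ?thesis using assms fin \<open>finite x\<close>
      by (simp add: cz_def W_def zs_sd_left mult_ac)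
  next
    case False
    then have "\<not> x \<ominus> A \<subseteq> N" using assms by simp
    then show ?thesis using assms False by (simp add: cz_def W_def supported_def)
  qed
qed

text \<open>The kernel \<open>zs x y\<close> is the CZ sign of the horizontal edges between a column
  with content \<open>x\<close> and the next one with content \<open>y\<close>; the sum over
  \<open>x\<close> is the X measurement. Left unnormalised.\<close>

definition hadamard_all :: "nat set \<Rightarrow> nat qvec \<Rightarrow> nat qvec" where
  "hadamard_all N u = (\<lambda>y. if y \<subseteq> N then \<Sum>x\<in>Pow N. zs x y * u x else 0)"

lemma supported_hadamard_all [simp]: "supported N (hadamard_all N u)"
  by (simp add: supported_def hadamard_all_def)

lemma hadamard_all_W:
  assumes "finite N" "A \<subseteq> N" "B \<subseteq> N"
  shows "hadamard_all N (W A B u) = (\<lambda>y. zs A B * W B A (hadamard_all N u) y)"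
proof
  fix y
  have fin: "finite A" "finite B" using assms finite_subset by blast+
  show "hadamard_all N (W A B u) y = zs A B * W B A (hadamard_all N u) y"
  proof (cases "y \<subseteq> N")
    case True
    then have "hadamard_all N (W A B u) y = (\<Sum>x\<in>Pow N. zs (x \<ominus> A) y * zs B (x \<ominus> A) * u x)"
      using sum_Pow_sd[OF assms(2), of "\<lambda>x. zs x y * (zs B x * u (x \<ominus> A))"]
      by (simp add: hadamard_all_def W_def mult_ac)
    also have "\<dots> = (\<Sum>x\<in>Pow N. zs A B * (zs A y * (zs x (y \<ominus> B) * u x)))"
      using True assms fin
      by (intro sum.cong refl)
        (auto simp: zs_sd_right zs_sd_left finite_subset zs_commute[of B] mult_ac)
    finally show ?thesis
      using True assms by (simp add: hadamard_all_def W_def sum_distrib_left)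
  next
    case False
    then have "\<not> y \<ominus> B \<subseteq> N" using assms by simp
    then show ?thesis using False by (simp add: hadamard_all_def W_def)
  qed
qed

lemma hadamard_all_twice:
  assumes "finite N" "supported N u"
  shows "hadamard_all N (hadamard_all N u) = (\<lambda>y. 2 ^ card N * u y)"
proof
  fix y
  show "hadamard_all N (hadamard_all N u) y = 2 ^ card N * u y"
  proof (cases "y \<subseteq> N")
    case True
    have "hadamard_all N (hadamard_all N u) y = (\<Sum>x\<in>Pow N. \<Sum>z\<in>Pow N. zs x y * (zs z x * u z))"
      using True by (simp add: hadamard_all_def sum_distrib_left)
    also have "\<dots> = (\<Sum>z\<in>Pow N. \<Sum>x\<in>Pow N. zs x y * (zs z x * u z))"
      by (rule sum.swap)
    also have "\<dots> = (\<Sum>z\<in>Pow N. (\<Sum>x\<in>Pow N. zs x (y \<ominus> z)) * u z)"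
      unfolding sum_distrib_right using assms True
      by (intro sum.cong refl) (auto simp: zs_sd_right finite_subset zs_commute mult_ac)
    also have "\<dots> = (\<Sum>z\<in>Pow N. if z = y then 2 ^ card N * u z else 0)"
    proof (intro sum.cong refl)
      fix z assume "z \<in> Pow N"
      moreover have "y \<ominus> z = {} \<longleftrightarrow> z = y" by (auto simp: sd_def)
      ultimately show "(\<Sum>x\<in>Pow N. zs x (y \<ominus> z)) * u z = (if z = y then 2 ^ card N * u z else 0)"
        using True assms by (simp add: sum_zs sd_subsetI)
    qed
    finally show ?thesis using True assms by (simp add: sum.delta)
  next
    case False then show ?thesis using assms by (simp add: hadamard_all_def supported_def)
  qed
qed

text \<open>\<open>transfer\<close> is the transfer map of one column of the cluster, measured in the X basis.\<close>

definition transfer :: "nat set \<Rightarrow> nat qvec \<Rightarrow> nat qvec" where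
  "transfer N u = hadamard_all N (cz u)"

text \<open>CZ turns X on \<open>A\<close> into X on \<open>A\<close> times Z on its neighbours; the
  Hadamard transform then exchanges X and Z.\<close>

definition transfer_label :: "nat set \<Rightarrow> nat set \<times> nat set \<Rightarrow> nat set \<times> nat set" where
  "transfer_label N = (\<lambda>(A, B). ((B \<ominus> nb A) \<inter> N, A))"

lemma supported_transfer [simp]: "supported N (transfer N u)"
  by (simp add: transfer_def)

lemma transfer_scale: "transfer N (\<lambda>x. c * u x) = (\<lambda>x. c * transfer N u x)"
  by (simp add: transfer_def hadamard_all_def cz_def sum_distrib_left mult_ac fun_eq_iff)

lemma transfer_add: "transfer N (\<lambda>x. u x + v x) = (\<lambda>x. transfer N u x + transfer N v x)"
  by (simp add: transfer_def hadamard_all_def cz_def sum.distrib algebra_simps fun_eq_iff)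

text \<open>The Clifford property. The scalar is fixed before \<open>u\<close>, so this is an
  identity of operators; that it squares to 1 is what removes it when a power is doubled.\<close>

lemma transfer_W:
  assumes "finite N" "A \<subseteq> N" "finite B" "transfer_label N (A, B) = (A', B')"
  shows "\<exists>c. c * c = 1 \<and> (\<forall>u. supported N u \<longrightarrow> transfer N (W A B u) = (\<lambda>x. c * W A' B' (transfer N u) x))"
proof (intro exI conjI allI impI)
  define B0 where "B0 = (B \<ominus> nb A) \<inter> N"
  have A': "A' = B0" "B' = A" using assms by (auto simp: transfer_label_def B0_def)
  show "(edge_sign Suc A * zs A B0) * (edge_sign Suc A * zs A B0) = 1"
    by (simp add: mult_ac)
  fix u assume u: "supported N u"
  have "transfer N (W A B u) = hadamard_all N (\<lambda>x. edge_sign Suc A * W A B0 (cz u) x)"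
    using assms u by (simp add: transfer_def cz_W B0_def W_Int)
  also have "\<dots> = (\<lambda>x. edge_sign Suc A * hadamard_all N (W A B0 (cz u)) x)"
    by (simp add: hadamard_all_def sum_distrib_left mult_ac fun_eq_iff)
  also have "\<dots> = (\<lambda>x. edge_sign Suc A * zs A B0 * W B0 A (transfer N u) x)"
    using assms by (subst hadamard_all_W) (auto simp: B0_def transfer_def mult_ac)
  finally show "transfer N (W A B u) = (\<lambda>x. (edge_sign Suc A * zs A B0) * W A' B' (transfer N u) x)"
    unfolding A' .
qed

lemma transfer_inj:
  assumes "finite N" "supported N u" "supported N v" "transfer N u = transfer N v"
  shows "u = v"
proof -
  have "hadamard_all N (transfer N u) = hadamard_all N (transfer N v)" using assms by simp
  then have "cz u = cz v"
    using assms by (simp add: transfer_def hadamard_all_twice fun_eq_iff)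
  then have "cz (cz u) = cz (cz v)" by simp
  then show ?thesis by simp
qed

text \<open>Adjacency is symmetric, so each edge inside \<open>A\<close> is counted twice. Hence
  conjugation by \<open>transfer\<close> preserves the square of a Pauli operator.\<close>

lemma nb_sign: "finite A \<Longrightarrow> A \<subseteq> N \<Longrightarrow> zs (nb A \<inter> N) A = 1"
proof -
  assume A: "finite A" "A \<subseteq> N"
  have "zs (nb A) A = zs (Suc ` A) A * zs (Suc -` A) A"
    using A by (simp add: nb_def zs_sd_left)
  also have "zs (Suc -` A) A = zs (Suc ` A) A"
    by (metis inj_Suc zs_commute zs_image)
  finally show ?thesis using A by (simp add: zs_Int_right)
qed

section \<open>Finite order of the transfer map up to scalars\<close>

lemma transfer_label_in: "A \<subseteq> N \<Longrightarrow> transfer_label N (A, B) \<in> Pow N \<times> Pow N"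
  by (auto simp: transfer_label_def)

lemma inj_on_transfer_label: "inj_on (transfer_label N) (Pow N \<times> Pow N)"
proof (rule inj_onI, clarify)
  fix A B A' B' assume "A \<subseteq> N" "B \<subseteq> N" "B' \<subseteq> N" and eq: "transfer_label N (A, B) = transfer_label N (A', B')"
  then have "A = A'" "(B \<ominus> nb A) \<inter> N = (B' \<ominus> nb A) \<inter> N" by (auto simp: transfer_label_def)
  moreover have "B = ((B \<ominus> nb A) \<inter> N) \<ominus> (nb A \<inter> N)" "B' = ((B' \<ominus> nb A) \<inter> N) \<ominus> (nb A \<inter> N)"
    using \<open>B \<subseteq> N\<close> \<open>B' \<subseteq> N\<close> by (auto simp: sd_def)
  ultimately show "A = A' \<and> B = B'" by metis
qed

lemma inj_on_finite_order:
  assumes "finite L" "inj_on f L" "f ` L \<subseteq> L"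
  obtains M where "M > 0" "\<And>x. x \<in> L \<Longrightarrow> (f ^^ M) x = x"
proof -
  \<comment> \<open>Extension by the identity, so that the theory of permutations applies.\<close>
  define p where "p x = (if x \<in> L then f x else x)" for x
  have "bij_betw f L L" using assms by (simp add: bij_betw_def endo_inj_surj)
  then have "p permutes L"
    by (intro bij_imp_permutes) (auto simp: p_def cong: bij_betw_cong)
  then have "permutation p" using assms permutation_permutes by blast
  then obtain M where M: "p ^^ M = id" "M > 0" using permutation_is_nilpotent by blast
  have "(f ^^ k) x = (p ^^ k) x \<and> (p ^^ k) x \<in> L" if "x \<in> L" for x k
    by (induction k) (use that assms in \<open>auto simp: p_def\<close>)
  with M show ?thesis by (intro that[of M]) auto
qed

lemma supported_transfer_pow: "supported N u \<Longrightarrow> supported N ((transfer N ^^ k) u)"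
  by (cases k) auto

lemma transfer_pow_scale: "(transfer N ^^ k) (\<lambda>x. c * u x) = (\<lambda>x. c * (transfer N ^^ k) u x)"
  by (induction k) (auto simp: transfer_scale)

lemma transfer_pow_add: "(transfer N ^^ k) (\<lambda>x. u x + v x) = (\<lambda>x. (transfer N ^^ k) u x + (transfer N ^^ k) v x)"
  by (induction k) (auto simp: transfer_add)

lemma transfer_pow_sum:
  "(transfer N ^^ k) (\<lambda>x. \<Sum>i\<in>I. u i x) = (\<lambda>x. \<Sum>i\<in>I. (transfer N ^^ k) (u i) x)"
proof (induction I rule: infinite_finite_induct)
  case (insert i I) then show ?case by (simp add: transfer_pow_add)
next
  case empty
  show ?case using transfer_pow_scale[of k N 0] by simp
next
  case (infinite I)
  then show ?case using transfer_pow_scale[of k N 0] by simp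
qed

lemma transfer_pow_W:
  assumes "finite N" "A \<subseteq> N" "B \<subseteq> N"
  shows "\<exists>c A' B'. c * c = 1 \<and> (transfer_label N ^^ k) (A, B) = (A', B') \<and> A' \<subseteq> N \<and> B' \<subseteq> N \<and>
    (\<forall>u. supported N u \<longrightarrow> (transfer N ^^ k) (W A B u) = (\<lambda>x. c * W A' B' ((transfer N ^^ k) u) x))"
proof (induction k)
  case 0 show ?case using assms by (intro exI[of _ 1]) auto
next
  case (Suc k)
  then obtain c A' B' where *: "c * c = 1" "(transfer_label N ^^ k) (A, B) = (A', B')" "A' \<subseteq> N" "B' \<subseteq> N"
    "\<And>u. supported N u \<Longrightarrow> (transfer N ^^ k) (W A B u) = (\<lambda>x. c * W A' B' ((transfer N ^^ k) u) x)"
    by blast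
  obtain A2 B2 where 2: "transfer_label N (A', B') = (A2, B2)" by fastforce
  then have "A2 \<subseteq> N" "B2 \<subseteq> N" using transfer_label_in[OF *(3), of B'] by auto
  moreover obtain c2 where c2: "c2 * c2 = 1"
    "\<And>u. supported N u \<Longrightarrow> transfer N (W A' B' u) = (\<lambda>x. c2 * W A2 B2 (transfer N u) x)"
    using transfer_W[OF assms(1) *(3) _ 2] finite_subset[OF *(4) assms(1)] by blast
  moreover have "(c * c2) * (c * c2) = (c * c) * (c2 * c2)" by (simp add: mult_ac)
  ultimately show ?case using * 2
    by (intro exI[of _ "c * c2"] exI[of _ A2] exI[of _ B2])
      (simp add: transfer_scale supported_transfer_pow mult_ac)
qed

text \<open>A Schur-type argument: a power fixing all labels commutes with all Pauli operators up to
  sign, and these act irreducibly, so after removing the signs the power is a scalar.\<close>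

lemma transfer_pow_period:
  assumes "finite N"
  obtains M c where "M > 0" "c \<noteq> 0" "\<And>u. supported N u \<Longrightarrow> (transfer N ^^ M) u = (\<lambda>x. c * u x)"
proof -
  have "transfer_label N ` (Pow N \<times> Pow N) \<subseteq> Pow N \<times> Pow N"
    using transfer_label_in by blast
  then obtain K where K: "K > 0" "\<And>l. l \<in> Pow N \<times> Pow N \<Longrightarrow> (transfer_label N ^^ K) l = l"
    using inj_on_finite_order[OF _ inj_on_transfer_label] assms by (metis finite_Pow_iff finite_SigmaI)
  \<comment> \<open>Doubling squares the sign by which the \<open>K\<close>-th power commutes with
    each Pauli operator, so the \<open>M\<close>-th power commutes exactly.\<close>
  define M where "M = K + K"
  have comm: "(transfer N ^^ M) (W A B u) = W A B ((transfer N ^^ M) u)"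
    if AB: "A \<subseteq> N" "B \<subseteq> N" and u: "supported N u" for A B u
  proof -
    obtain c where c: "c * c = 1"
      "\<And>u. supported N u \<Longrightarrow> (transfer N ^^ K) (W A B u) = (\<lambda>x. c * W A B ((transfer N ^^ K) u) x)"
      using transfer_pow_W[OF assms AB, of K] K(2)[of "(A, B)"] AB by auto
    have cc: "c * (c * z) = z" for z using c(1) by (metis mult.assoc mult_1)
    show ?thesis
      using c(2)[OF u] c(2)[OF supported_transfer_pow[OF u], of K]
      by (simp add: M_def funpow_add transfer_pow_scale cc)
  qed
  define \<delta> :: "nat set \<Rightarrow> nat qvec" where "\<delta> A = (\<lambda>x. if x = A then 1 else 0)" for A
  have \<delta>: "supported N (\<delta> A)" if "A \<subseteq> N" for A using that by (auto simp: \<delta>_def supported_def)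
  define c where "c = (transfer N ^^ M) (\<delta> {}) {}"
  \<comment> \<open>The empty configuration is, up to scalars, the only common +1 eigenvector of the
    Z operators, so a commuting map preserves its line; X operators then carry \<open>c\<close> to
    all other basis vectors.\<close>
  have 0: "(transfer N ^^ M) (\<delta> {}) = (\<lambda>x. c * \<delta> {} x)"
  proof
    fix x
    show "(transfer N ^^ M) (\<delta> {}) x = c * \<delta> {} x"
    proof (cases "x \<subseteq> N \<and> x \<noteq> {}")
      case True
      then obtain a where a: "a \<in> x" "a \<in> N" by auto
      have "W {} {a} (\<delta> {}) = \<delta> {}" by (auto simp: W_def \<delta>_def zs_singleton)
      then have "(transfer N ^^ M) (\<delta> {}) = W {} {a} ((transfer N ^^ M) (\<delta> {}))"
        using comm[of "{}" "{a}" "\<delta> {}"] a \<delta> by simp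
      then have "(transfer N ^^ M) (\<delta> {}) x = - (transfer N ^^ M) (\<delta> {}) x"
        using a by (metis (no_types, lifting) W_def mult_minus1 sd_simps(2) zs_singleton(2))
      then show ?thesis using True by (simp add: \<delta>_def)
    next
      case False
      then show ?thesis
        using supported_transfer_pow[OF \<delta>[of "{}"], of M] by (auto simp: supported_def c_def \<delta>_def)
    qed
  qed
  have 1: "(transfer N ^^ M) (\<delta> A) = (\<lambda>x. c * \<delta> A x)" if "A \<subseteq> N" for A
  proof -
    have *: "W A {} (\<delta> {}) = \<delta> A"
      by (auto simp: W_def \<delta>_def sd_def fun_eq_iff)
    show ?thesis
      using comm[OF that _ \<delta>[of "{}"], of "{}"] unfolding * 0 W_scale by simp
  qed
  have 2: "(transfer N ^^ M) u = (\<lambda>x. c * u x)" if "supported N u" for u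
  proof -
    have u: "u = (\<lambda>x. \<Sum>A\<in>Pow N. u A * \<delta> A x)"
      using that assms
      by (auto simp: \<delta>_def supported_def fun_eq_iff if_distrib[of "(*) _"] cong: if_cong)
    have "(transfer N ^^ M) u = (\<lambda>x. \<Sum>A\<in>Pow N. u A * (transfer N ^^ M) (\<delta> A) x)"
      by (subst u) (simp add: transfer_pow_sum transfer_pow_scale)
    also have "\<dots> = (\<lambda>x. \<Sum>A\<in>Pow N. c * (u A * \<delta> A x))"
      by (intro ext sum.cong) (auto simp: 1)
    also have "\<dots> = (\<lambda>x. c * u x)"
      by (subst (2) u) (simp add: sum_distrib_left)
    finally show ?thesis .
  qed
  have inj: "u = v" if "(transfer N ^^ k) u = (transfer N ^^ k) v" "supported N u" "supported N v" for u v k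
    using that
  proof (induction k)
    case (Suc k)
    then show ?case using transfer_inj[OF assms, of "(transfer N ^^ k) u" "(transfer N ^^ k) v"]
      by (simp add: supported_transfer_pow)
  qed simp
  have "c \<noteq> 0"
  proof
    assume "c = 0"
    then have "(transfer N ^^ M) (\<delta> {}) = (transfer N ^^ M) (\<lambda>_. 0)"
      using 2[of "\<delta> {}"] 2[of "\<lambda>_. 0"] \<delta>[of "{}"] by (simp add: supported_def)
    then have "\<delta> {} = (\<lambda>_. 0)" using inj \<delta>[of "{}"] by (simp add: supported_def)
    then have "\<delta> {} {} = 0" by simp
    then show False by (simp add: \<delta>_def)
  qed
  with 2 K(1) show ?thesis by (intro that[of M c]) (auto simp: M_def)
qed

section \<open>Operators realised by columns\<close>

definition phase_shift :: "nat \<Rightarrow> complex \<Rightarrow> nat qvec \<Rightarrow> nat qvec" where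
  "phase_shift k \<omega> u = (\<lambda>x. (if k \<in> x then \<omega> else 1) * u x)"

text \<open>Steps are peeled off at the input side, in the order in which columns are measured.
  Rescaling costs no column, and each column carries at most one rotated qubit.\<close>

inductive reach :: "nat set \<Rightarrow> nat \<Rightarrow> nat qvec \<Rightarrow> nat qvec \<Rightarrow> bool" for N where
  reach_refl: "reach N 0 u u"
| reach_scale: "c \<noteq> 0 \<Longrightarrow> reach N l (\<lambda>x. c * u x) v \<Longrightarrow> reach N l u v"
| reach_step: "cmod \<omega> = 1 \<Longrightarrow> reach N l (transfer N (phase_shift k \<omega> u)) v \<Longrightarrow> reach N (Suc l) u v"

lemma reach_trans: "reach N l u v \<Longrightarrow> reach N l' v w \<Longrightarrow> reach N (l + l') u w"
  by (induction rule: reach.induct) (auto intro: reach.intros)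

definition realizable :: "nat set \<Rightarrow> (nat qvec \<Rightarrow> nat qvec) \<Rightarrow> bool" where
  "realizable N f \<longleftrightarrow> (\<forall>u. supported N u \<longrightarrow> supported N (f u) \<and> (\<exists>l. reach N l u (f u)))"

lemma realizable_cong: "realizable N f \<Longrightarrow> (\<And>u. supported N u \<Longrightarrow> f u = g u) \<Longrightarrow> realizable N g"
  by (simp add: realizable_def)

lemma realizable_comp: "realizable N f \<Longrightarrow> realizable N g \<Longrightarrow> realizable N (\<lambda>u. g (f u))"
  unfolding realizable_def by (meson reach_trans)

lemma realizable_scale: "c \<noteq> 0 \<Longrightarrow> realizable N (\<lambda>u x. c * u x)"
  unfolding realizable_def supported_def by (metis mult_zero_right reach_refl reach_scale)

lemma realizable_scale': "realizable N f \<Longrightarrow> c \<noteq> 0 \<Longrightarrow> realizable N (\<lambda>u x. c * f u x)"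
  using realizable_comp[OF _ realizable_scale] .

lemma realizable_tr_ph: "cmod \<omega> = 1 \<Longrightarrow> realizable N (\<lambda>u. transfer N (phase_shift k \<omega> u))"
  unfolding realizable_def by (auto intro: reach.intros)

lemma realizable_tr: "realizable N (transfer N)"
  using realizable_tr_ph[of 1] by (simp add: phase_shift_def)

text \<open>Some power of \<open>transfer\<close> is a nonzero scalar, so the power before it,
  rescaled, is a two-sided inverse made of further plain columns.\<close>

lemma realizable_tr_inverse:
  assumes "finite N"
  obtains g where "realizable N g" "\<And>u. supported N u \<Longrightarrow> g (transfer N u) = u"
    "\<And>u. supported N u \<Longrightarrow> transfer N (g u) = u"
proof -
  obtain M c where M: "M > 0" "c \<noteq> 0" "\<And>u. supported N u \<Longrightarrow> (transfer N ^^ M) u = (\<lambda>x. c * u x)"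
    using transfer_pow_period[OF assms] by metis
  have pow: "realizable N (transfer N ^^ k)" for k
  proof (induction k)
    case 0 show ?case using realizable_scale[of 1 N] by (simp add: id_def)
  next
    case (Suc k) then show ?case using realizable_comp[OF _ realizable_tr] by (simp add: o_def)
  qed
  define g where "g u = (\<lambda>x. inverse c * (transfer N ^^ (M - 1)) u x)" for u
  have "realizable N g" unfolding g_def using realizable_scale'[OF pow] M by simp
  moreover have "g (transfer N u) = u" if "supported N u" for u
  proof -
    have "(transfer N ^^ (M - 1)) (transfer N u) = (transfer N ^^ M) u"
      using M(1) by (metis Suc_pred' comp_apply funpow_Suc_right)
    then show ?thesis using M that by (simp add: g_def fun_eq_iff)
  qed
  moreover have "transfer N (g u) = u" if "supported N u" for u
  proof -
    have "transfer N ((transfer N ^^ (M - 1)) u) = (transfer N ^^ M) u"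
      using M(1) by (metis Suc_pred' comp_apply funpow.simps(2))
    then show ?thesis using M that by (simp add: g_def transfer_scale fun_eq_iff)
  qed
  ultimately show ?thesis by (rule that)
qed

section \<open>Rotations about Pauli axes and their closure properties\<close>

definition rot :: "complex \<Rightarrow> real \<Rightarrow> real \<Rightarrow> nat set \<Rightarrow> nat set \<Rightarrow> nat qvec \<Rightarrow> nat qvec" where
  "rot \<kappa> a b A B u = (\<lambda>x. of_real a * u x + of_real b * \<kappa> * W A B u x)"

text \<open>Since \<open>\<kappa> W A B\<close> squares to \<open>-1\<close>, the operator \<open>rot \<kappa> (cos t) (sin t) A B\<close> is the
  exponential of \<open>t \<kappa> W A B\<close>.\<close>

definition rotatable :: "nat set \<Rightarrow> nat set \<Rightarrow> nat set \<Rightarrow> bool" where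
  "rotatable N A B \<longleftrightarrow> (\<forall>\<kappa> a b. \<kappa> * \<kappa> = - zs A B \<longrightarrow> a \<noteq> 0 \<or> b \<noteq> 0 \<longrightarrow> realizable N (rot \<kappa> a b A B))"

lemma rotatableD: "rotatable N A B \<Longrightarrow> \<kappa> * \<kappa> = - zs A B \<Longrightarrow> a \<noteq> 0 \<or> b \<noteq> 0 \<Longrightarrow> realizable N (rot \<kappa> a b A B)"
  by (simp add: rotatable_def)

text \<open>With \<open>\<kappa>\<close> = \<i> or -\<i> the rotation is diagonal with entries
  \<open>z\<close> and \<open>cnj z\<close>, that is, \<open>z\<close> times the phase shift by
  \<open>cnj z / z\<close>. The column that inserts this phase also applies \<open>transfer\<close>,
  which is then undone.\<close>

lemma rotatable_Z:
  assumes "finite N"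
  shows "rotatable N {} {k}"
  unfolding rotatable_def
proof (intro allI impI)
  fix \<kappa> :: complex and a b :: real
  assume \<kappa>: "\<kappa> * \<kappa> = - zs {} {k}" and ab: "a \<noteq> 0 \<or> b \<noteq> 0"
  have "(\<kappa> - \<i>) * (\<kappa> + \<i>) = 0" using \<kappa> by (simp add: algebra_simps)
  then have \<kappa>': "\<kappa> = \<i> \<or> \<kappa> = - \<i>" by (auto simp: eq_neg_iff_add_eq_0)
  define z where "z = of_real a + of_real b * \<kappa>"
  have z: "cnj z = of_real a - of_real b * \<kappa>" "z \<noteq> 0" 
    using \<kappa>' ab by (auto simp: z_def complex_eq_iff)
  obtain g where g: "realizable N g" "\<And>u. supported N u \<Longrightarrow> g (transfer N u) = u"
    using realizable_tr_inverse[OF assms] by metis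
  have "cmod (cnj z / z) = 1" using z(2) by (simp add: norm_divide)
  then have "realizable N (\<lambda>u x. z * g (transfer N (phase_shift k (cnj z / z) u)) x)"
    using realizable_scale'[OF realizable_comp[OF realizable_tr_ph g(1)]] z by blast
  then show "realizable N (rot \<kappa> a b {} {k})"
  proof (rule realizable_cong)
    fix u assume u: "supported N u"
    then have "supported N (phase_shift k (cnj z / z) u)" by (simp add: supported_def phase_shift_def)
    then have "(\<lambda>x. z * g (transfer N (phase_shift k (cnj z / z) u)) x) = (\<lambda>x. (if k \<in> x then cnj z else z) * u x)"
      using z(2) by (auto simp: g phase_shift_def)
    also have "\<dots> = rot \<kappa> a b {} {k} u"
      unfolding z(1) by (simp add: rot_def W_def zs_singleton z_def fun_eq_iff ring_distribs)
    finally show "(\<lambda>x. z * g (transfer N (phase_shift k (cnj z / z) u)) x) = rot \<kappa> a b {} {k} u" .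
  qed
qed

lemma transfer_rot: "transfer N (rot \<kappa> a b A B u) = (\<lambda>x. of_real a * transfer N u x + of_real b * \<kappa> * transfer N (W A B u) x)"
  unfolding rot_def transfer_add transfer_scale by (simp add: fun_eq_iff transfer_scale)

text \<open>Conjugation by \<open>transfer\<close> carries one axis to the other up to a sign
  \<open>c\<close>, which is absorbed into \<open>\<kappa>\<close>; this is possible because
  \<open>rotatable\<close> quantifies over every root \<open>\<kappa>\<close>.\<close>

lemma rotatable_tr:
  assumes "finite N" "A \<subseteq> N" "B \<subseteq> N" "rotatable N A B" "transfer_label N (A, B) = (A', B')"
  shows "rotatable N A' B'"
  unfolding rotatable_def
proof (intro allI impI)
  fix \<kappa> :: complex and a b :: real
  assume \<kappa>: "\<kappa> * \<kappa> = - zs A' B'" and ab: "a \<noteq> 0 \<or> b \<noteq> 0"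
  have fin: "finite A" "finite B" using assms finite_subset by blast+
  obtain g where g: "realizable N g" "\<And>u. supported N u \<Longrightarrow> transfer N (g u) = u"
    using realizable_tr_inverse[OF assms(1)] by metis
  obtain c where c: "c * c = 1"
    "\<And>u. supported N u \<Longrightarrow> transfer N (W A B u) = (\<lambda>x. c * W A' B' (transfer N u) x)"
    using transfer_W[OF assms(1,2) fin(2) assms(5)] by blast
  have "zs A' B' = zs ((B \<ominus> nb A) \<inter> N) A" using assms by (auto simp: transfer_label_def)
  also have "\<dots> = zs B A * zs (nb A \<inter> N) A"
    using fin assms by (simp add: zs_Int_right zs_sd_left)
  finally have "zs A' B' = zs A B" using nb_sign[OF fin(1) assms(2)] by (simp add: zs_commute)
  moreover have "(\<kappa> * c) * (\<kappa> * c) = (\<kappa> * \<kappa>) * (c * c)" by (simp add: mult_ac)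
  ultimately have "(\<kappa> * c) * (\<kappa> * c) = - zs A B" using \<kappa> c by simp
  then have "realizable N (\<lambda>u. transfer N (rot (\<kappa> * c) a b A B (g u)))"
    using realizable_comp[OF realizable_comp[OF g(1) rotatableD[OF assms(4)]] realizable_tr] ab by blast
  then show "realizable N (rot \<kappa> a b A' B')"
  proof (rule realizable_cong)
    fix u assume u: "supported N u"
    then have "supported N (g u)" using g by (auto simp: realizable_def)
    moreover have cc: "c * (c * z) = z" for z using c(1) by (metis mult.assoc mult_1)
    ultimately show "transfer N (rot (\<kappa> * c) a b A B (g u)) = rot \<kappa> a b A' B' u"
      unfolding transfer_rot using u c(2)[of "g u"] by (simp add: g rot_def mult_ac cc)
  qed
qed

text \<open>Conjugating a rotation about Q by a quarter turn about an anticommuting P gives a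
  rotation about PQ: if p = \<kappa>1 P squares to -1 then (1 + p) Q (1 - p) = (1 + p)(1 + p) Q = 2
  p Q.\<close>

lemma rotatable_mult:
  assumes fin: "finite A" "finite B" "finite A'" "finite B'"
    and rotatable: "rotatable N A B" "rotatable N A' B'" and anti: "zs B' A * zs B A' = - 1"
  shows "rotatable N (A \<ominus> A') (B \<ominus> B')"
  unfolding rotatable_def
proof (intro allI impI)
  fix \<kappa> :: complex and a b :: real
  assume \<kappa>: "\<kappa> * \<kappa> = - zs (A \<ominus> A') (B \<ominus> B')" and ab: "a \<noteq> 0 \<or> b \<noteq> 0"
  define \<alpha> where "\<alpha> = zs B' A"
  have \<alpha>: "\<alpha> * \<alpha> = 1" "zs B A' = - \<alpha>" "\<alpha> \<noteq> 0"
    using anti zs_cases[of B' A] by (auto simp: \<alpha>_def)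
  define s where "s = zs B A"
  have s: "s * s = 1" by (simp add: s_def)
  have "\<exists>\<kappa>1. \<kappa>1 * \<kappa>1 = - s \<and> \<kappa>1 \<noteq> 0"
  proof (cases "s = 1")
    case True then show ?thesis by (intro exI[of _ \<i>]) simp
  next
    case False then show ?thesis using zs_cases[of B A] by (intro exI[of _ 1]) (simp add: s_def)
  qed
  then obtain \<kappa>1 where \<kappa>1: "\<kappa>1 * \<kappa>1 = - s" "\<kappa>1 \<noteq> 0" by blast
  \<comment> \<open>Solved from the requirement that the product axis carries the prescribed
    \<open>\<kappa>\<close>; \<open>\<alpha>\<close> is the sign from multiplying the two Pauli
    operators.\<close>
  define \<kappa>2 where "\<kappa>2 = \<kappa> / (\<kappa>1 * \<alpha>)"
  have \<kappa>_eq: "\<kappa> = \<kappa>1 * \<kappa>2 * \<alpha>" using \<alpha> \<kappa>1 by (simp add: \<kappa>2_def)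
  have "zs (A \<ominus> A') (B \<ominus> B') = s * \<alpha> * (- \<alpha>) * zs A' B'"
    using fin \<alpha>(2)
    by (simp add: zs_sd_left zs_sd_right s_def \<alpha>_def zs_commute[of A B] zs_commute[of A' B] zs_commute[of A B'] mult_ac)
  then have "\<kappa> * \<kappa> = s * zs A' B'" using \<kappa> \<alpha>(1) by (simp add: mult_ac)
  moreover have "\<kappa> * \<kappa> = (\<kappa>1 * \<kappa>1) * (\<alpha> * \<alpha>) * (\<kappa>2 * \<kappa>2)" by (simp add: \<kappa>_eq mult_ac)
  ultimately have "- (s * (\<kappa>2 * \<kappa>2)) = s * zs A' B'" using \<kappa>1 \<alpha>(1) by simp
  then have "s * (- (s * (\<kappa>2 * \<kappa>2))) = s * (s * zs A' B')" by (rule arg_cong)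
  moreover have ss: "s * (s * z) = z" for z unfolding mult.assoc[symmetric] s by simp
  ultimately have \<kappa>2: "\<kappa>2 * \<kappa>2 = - zs A' B'" unfolding mult_minus_right ss by (metis minus_minus)
  have \<kappa>1': "\<kappa>1 * \<kappa>1 = - zs A B" using \<kappa>1 by (simp add: s_def zs_commute[of B A])
  have o: "realizable N (rot \<kappa>1 1 (-1) A B)" "realizable N (rot \<kappa>2 a b A' B')" "realizable N (rot \<kappa>1 1 1 A B)"
    using rotatableD[OF rotatable(1) \<kappa>1'] rotatableD[OF rotatable(2) \<kappa>2 ab] by simp_all
  \<comment> \<open>The factors 1 + p and 1 - p multiply to 2, which the scalar 1/2 cancels.\<close>
  have "realizable N (\<lambda>u x. (1/2) * rot \<kappa>1 1 1 A B (rot \<kappa>2 a b A' B' (rot \<kappa>1 1 (-1) A B u)) x)"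
    using realizable_scale'[OF realizable_comp[OF realizable_comp[OF o(1,2)] o(3)], of "1/2"] by simp
  then show "realizable N (rot \<kappa> a b (A \<ominus> A') (B \<ominus> B'))"
  proof (rule realizable_cong)
    fix u
    define P Q w where "P = W A B u" and "Q = W A' B' u" and "w = W (A \<ominus> A') (B \<ominus> B') u"
    have WP: "W A B P = (\<lambda>x. s * u x)" "W A B Q = (\<lambda>x. \<alpha> * w x)" 
      "W A' B' P = (\<lambda>x. - \<alpha> * w x)" "W A B w = (\<lambda>x. s * \<alpha> * Q x)"
      using fin \<alpha>(2)
      by (simp_all add: P_def Q_def w_def W_W s_def \<alpha>_def sd_commute[of A' A] sd_commute[of B' B] zs_sd_left)
    have W1: "W A' B' (\<lambda>x. u x + (- \<kappa>1) * P x) = (\<lambda>x. Q x + (- \<kappa>1) * (- \<alpha> * w x))"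
      unfolding W_add W_scale WP Q_def ..
    have v1: "rot \<kappa>1 1 (-1) A B u = (\<lambda>x. u x + (- \<kappa>1) * P x)"
      by (simp add: rot_def P_def)
    have v2: "rot \<kappa>2 a b A' B' (rot \<kappa>1 1 (-1) A B u) =
      (\<lambda>x. a * u x + (- a * \<kappa>1) * P x + (b * \<kappa>2) * Q x + (b * \<kappa>2 * \<kappa>1 * \<alpha>) * w x)"
      unfolding v1 unfolding rot_def W1 by (simp add: algebra_simps)
    have W2: "W A B (\<lambda>x. a * u x + (- a * \<kappa>1) * P x + (b * \<kappa>2) * Q x + (b * \<kappa>2 * \<kappa>1 * \<alpha>) * w x) =
      (\<lambda>x. a * P x + (- a * \<kappa>1) * (s * u x) + (b * \<kappa>2) * (\<alpha> * w x) + (b * \<kappa>2 * \<kappa>1 * \<alpha>) * (s * \<alpha> * Q x))"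
      unfolding W_add W_scale WP P_def[symmetric] ..
    have ks: "\<kappa>1 * (\<kappa>1 * (s * z)) = - z" "\<alpha> * (\<alpha> * z) = z" for z
      unfolding mult.assoc[symmetric] \<alpha>(1) \<kappa>1(1) by (simp_all add: s)
    show "(\<lambda>x. (1/2) * rot \<kappa>1 1 1 A B (rot \<kappa>2 a b A' B' (rot \<kappa>1 1 (-1) A B u)) x) =
        rot \<kappa> a b (A \<ominus> A') (B \<ominus> B') u"
    proof
      fix x
      have "rot \<kappa>1 1 1 A B (rot \<kappa>2 a b A' B' (rot \<kappa>1 1 (-1) A B u)) x =
        a * u x + (- a * \<kappa>1) * P x + (b * \<kappa>2) * Q x + (b * \<kappa>2 * \<kappa>1 * \<alpha>) * w x +
        \<kappa>1 * (a * P x + (- a * \<kappa>1) * (s * u x) + (b * \<kappa>2) * (\<alpha> * w x) + (b * \<kappa>2 * \<kappa>1 * \<alpha>) * (s * \<alpha> * Q x))"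
        unfolding v2 unfolding rot_def W2 by simp
      also have "\<dots> = 2 * (a * u x + b * \<kappa> * w x)"
      proof -
        have "\<kappa>1 * ((- a * \<kappa>1) * (s * u x)) = - a * (\<kappa>1 * (\<kappa>1 * (s * u x)))" 
          "\<kappa>1 * ((b * \<kappa>2 * \<kappa>1 * \<alpha>) * (s * \<alpha> * Q x)) = b * \<kappa>2 * (\<kappa>1 * (\<kappa>1 * (s * (\<alpha> * (\<alpha> * Q x)))))"
          by (simp_all add: mult_ac)
        then show ?thesis unfolding ks by (simp add: \<kappa>_eq algebra_simps)
      qed
      finally show "(1/2) * rot \<kappa>1 1 1 A B (rot \<kappa>2 a b A' B' (rot \<kappa>1 1 (-1) A B u)) x =
        rot \<kappa> a b (A \<ominus> A') (B \<ominus> B') u x"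
        by (simp add: rot_def w_def)
    qed
  qed
qed

section \<open>State synthesis\<close>

lemma supported_mono: "A \<subseteq> B \<Longrightarrow> supported A u \<Longrightarrow> supported B u"
  unfolding supported_def by blast

context
  fixes n :: nat and N :: "nat set"
  defines "N \<equiv> {..<n}"
begin

section \<open>All tensor products of sigma_z as rotation axes\<close>

lemma rotatable_X: "k < n \<Longrightarrow> rotatable N {k} {}"
  by (rule rotatable_tr[of N "{}" "{k}"]) (auto simp: N_def transfer_label_def nb_def rotatable_Z)

lemma rotatable_Y: "k < n \<Longrightarrow> rotatable N {k} {k}"
  using rotatable_mult[of "{k}" "{}" "{}" "{k}" N] rotatable_X rotatable_Z[of N k] by (simp add: zs_singleton N_def)

text \<open>To change the factor at one qubit, multiply the axis by the one-qubit Pauli that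
  anticommutes with that factor: Y exchanges X and Z, and X turns Y into Z.\<close>

lemma rotatable_X_to_Z:
  assumes "finite A" "finite B" "rotatable N A B" "k < n" "k \<in> A" "k \<notin> B"
  shows "rotatable N (A - {k}) (insert k B)"
proof -
  have "rotatable N (A \<ominus> {k}) (B \<ominus> {k})"
    by (rule rotatable_mult) (use assms rotatable_Y in \<open>auto simp: zs_singleton\<close>)
  moreover have "A \<ominus> {k} = A - {k}" "B \<ominus> {k} = insert k B" using assms by (auto simp: sd_def)
  ultimately show ?thesis by simp
qed

lemma rotatable_Z_to_X:
  assumes "finite A" "finite B" "rotatable N A B" "k < n" "k \<notin> A" "k \<in> B"
  shows "rotatable N (insert k A) (B - {k})"
proof -
  have "rotatable N (A \<ominus> {k}) (B \<ominus> {k})"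
    by (rule rotatable_mult) (use assms rotatable_Y in \<open>auto simp: zs_singleton\<close>)
  moreover have "B \<ominus> {k} = B - {k}" "A \<ominus> {k} = insert k A" using assms by (auto simp: sd_def)
  ultimately show ?thesis by simp
qed

lemma rotatable_Y_to_Z:
  assumes "finite A" "finite B" "rotatable N A B" "k < n" "k \<in> A" "k \<in> B"
  shows "rotatable N (A - {k}) B"
proof -
  have "rotatable N (A \<ominus> {k}) (B \<ominus> {})"
    by (rule rotatable_mult) (use assms rotatable_X in \<open>auto simp: zs_singleton\<close>)
  moreover have "A \<ominus> {k} = A - {k}" using assms by (auto simp: sd_def)
  ultimately show ?thesis by simp
qed

lemma rotatable_to_Z:
  assumes "finite A" "finite B" "A \<subseteq> N" "A \<inter> B = {}" "rotatable N A B"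
  shows "rotatable N {} (A \<union> B)"
  using assms
proof (induction A arbitrary: B rule: finite_induct)
  case (insert k A)
  have "rotatable N (insert k A - {k}) (insert k B)"
    by (rule rotatable_X_to_Z) (use insert in \<open>auto simp: N_def\<close>)
  then have "rotatable N {} (A \<union> insert k B)"
    using insert by (intro insert.IH) auto
  then show ?case by simp
qed simp

text \<open>Z on \<open>U\<close> and Z on \<open>V\<close> commute. Changing the factor of
  \<open>V\<close> at \<open>k\<close> into X makes the axes anticommute; their product has Y at
  \<open>k\<close>, which is converted back to Z.\<close>

lemma rotatable_merge:
  assumes "finite U" "finite V" "rotatable N {} U" "rotatable N {} V" "k < n" "k \<in> U" "k \<in> V"
  shows "rotatable N {} (U \<ominus> (V - {k}))"
proof -
  have V: "rotatable N {k} (V - {k})"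
    using rotatable_Z_to_X[of "{}" V k] assms by simp
  have "rotatable N ({k} \<ominus> {}) ((V - {k}) \<ominus> U)"
    by (rule rotatable_mult) (use assms V in \<open>auto simp: zs_singleton\<close>)
  then have "rotatable N {k} (U \<ominus> (V - {k}))" by (simp add: sd_commute)
  then have "rotatable N ({k} - {k}) (U \<ominus> (V - {k}))"
    using assms by (intro rotatable_Y_to_Z) (auto simp: sd_def)
  then show ?thesis by simp
qed

text \<open>The source of all multi-qubit axes: \<open>transfer\<close> sends X at \<open>k\<close>
  to Z at \<open>k\<close> times X on its neighbours, and those X become Z. At the borders a
  neighbour is missing.\<close>

lemma rotatable_triple:
  assumes "k < n"
  shows "rotatable N {} (insert k ({Suc k} \<union> Suc -` {k}) \<inter> N)"
proof -
  have nb: "nb {k} = {Suc k} \<union> Suc -` {k}" by (auto simp: nb_def sd_def)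
  have fin: "finite (nb {k})" by simp
  have "rotatable N (nb {k} \<inter> N) {k}"
    by (rule rotatable_tr[of N "{k}" "{}"]) (use assms rotatable_X in \<open>auto simp: transfer_label_def N_def\<close>)
  then have "rotatable N {} ((nb {k} \<inter> N) \<union> {k})"
    using fin by (intro rotatable_to_Z) (auto simp: nb)
  moreover have "(nb {k} \<inter> N) \<union> {k} = insert k ({Suc k} \<union> Suc -` {k}) \<inter> N"
    using assms by (auto simp: nb N_def)
  ultimately show ?thesis by simp
qed

text \<open>At row 0 the triple is already a pair; merging a pair with the next triple moves it up
  by one row.\<close>

lemma rotatable_pair: "Suc k < n \<Longrightarrow> rotatable N {} {k, Suc k}"
proof (induction k)
  case 0
  moreover have "insert 0 ({Suc 0} \<union> Suc -` {0}) \<inter> N = {0, Suc 0}" using 0 by (auto simp: N_def)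
  ultimately show ?case using rotatable_triple[of 0] by simp
next
  case (Suc k)
  have *: "insert (Suc k) ({Suc (Suc k)} \<union> Suc -` {Suc k}) \<inter> N = {k, Suc k, Suc (Suc k)}"
    using Suc.prems by (auto simp: N_def)
  have "rotatable N {} ({k, Suc k} \<ominus> ({k, Suc k, Suc (Suc k)} - {Suc k}))"
    by (rule rotatable_merge) (use Suc rotatable_triple[of "Suc k"] * in auto)
  moreover have "{k, Suc k} \<ominus> ({k, Suc k, Suc (Suc k)} - {Suc k}) = {Suc k, Suc (Suc k)}"
    by (auto simp: sd_def)
  ultimately show ?case by simp
qed

lemma rotatable_prefix: "t < n \<Longrightarrow> rotatable N {} {..t}"
proof (induction t)
  case 0
  then show ?case using rotatable_Z[of N 0] by (simp add: N_def)
next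
  case (Suc t)
  have "rotatable N {} ({..t} \<ominus> ({t, Suc t} - {t}))"
    by (rule rotatable_merge) (use Suc rotatable_pair in auto)
  moreover have "{..t} \<ominus> ({t, Suc t} - {t}) = {..Suc t}" by (auto simp: sd_def)
  ultimately show ?case by simp
qed

text \<open>Start from all rows up to the maximum \<open>t\<close> of \<open>T\<close> and sweep
  upwards, deleting the rows that are not in \<open>T\<close>. The top row is never deleted, so
  there is always a row to merge at.\<close>

lemma rotatable_Zs:
  assumes "T \<subseteq> N" "T \<noteq> {}"
  shows "rotatable N {} T"
proof -
  have fin: "finite T" using assms finite_subset by (auto simp: N_def)
  define t where "t = Max T"
  have t: "t \<in> T" "t < n" "\<And>x. x \<in> T \<Longrightarrow> x \<le> t"
    using assms fin Max_in[of T] unfolding t_def by (auto simp: N_def)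
  have "j \<le> t \<Longrightarrow> rotatable N {} ({j..t} \<union> (T \<inter> {..<j}))" for j
  proof (induction j)
    case 0 
    show ?case using rotatable_prefix[OF t(2)] by (simp add: atLeast0AtMost)
  next
    case (Suc j)
    let ?U = "{j..t} \<union> (T \<inter> {..<j})"
    show ?case
    proof (cases "j \<in> T")
      case True
      then have "{Suc j..t} \<union> (T \<inter> {..<Suc j}) = ?U" using Suc.prems by (auto simp: not_less_eq_eq less_Suc_eq le_less)
      then show ?thesis using Suc by simp
    next
      case False
      \<comment> \<open>Merging with the pair at \<open>Suc j\<close> toggles \<open>j\<close>
        alone; \<open>Suc j\<close> belongs to the set because \<open>Suc j \<le> t\<close>.\<close>
      have "rotatable N {} (?U \<ominus> ({j, Suc j} - {Suc j}))"
        by (rule rotatable_merge) (use Suc rotatable_pair[of j] t fin in auto)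
      moreover have "?U \<ominus> ({j, Suc j} - {Suc j}) = {Suc j..t} \<union> (T \<inter> {..<Suc j})"
        using False Suc.prems by (auto simp: sd_def less_Suc_eq Suc_le_eq le_less)
      ultimately show ?thesis by simp
    qed
  qed
  from this[of t] have "rotatable N {} ({t} \<union> (T \<inter> {..<t}))" by simp
  moreover have "{t} \<union> (T \<inter> {..<t}) = T" using t by (auto simp: le_less)
  ultimately show ?thesis by simp
qed

section \<open>Diagonal unitaries\<close>

lemma Im_zs: "Im (zs A B) = 0"
  using zs_cases[of A B] by auto

lemma realizable_phases:
  assumes "F \<subseteq> Pow N"
  shows "realizable N (\<lambda>u x. cis (\<Sum>T\<in>F. t T * Re (zs T x)) * u x)"
proof -
  have "finite F" using assms finite_subset by (auto simp: N_def)
  then show ?thesis using assms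
  proof (induction F rule: finite_induct)
    case empty
    show ?case using realizable_scale[of 1 N] by simp
  next
    case (insert T F)
    have "realizable N (\<lambda>u x. cis (t T * Re (zs T x)) * u x)"
    proof (cases "T = {}")
      \<comment> \<open>The empty product is a global phase, obtained by rescaling instead of a
        rotation.\<close>
      case True
      then show ?thesis using realizable_scale[of "cis (t T)" N] by simp
    next
      case False
      have "realizable N (rot \<i> (cos (t T)) (sin (t T)) {} T)"
        by (intro rotatableD rotatable_Zs) (use insert False sin_zero_abs_cos_one[of "t T"] in auto)
      then show ?thesis
      proof (rule realizable_cong)
        fix u show "rot \<i> (cos (t T)) (sin (t T)) {} T u = (\<lambda>x. cis (t T * Re (zs T x)) * u x)"
        proof
          fix x
          show "rot \<i> (cos (t T)) (sin (t T)) {} T u x = cis (t T * Re (zs T x)) * u x"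
            using zs_cases[of T x] by (auto simp: rot_def W_def complex_eq_iff)
        qed
      qed
    qed
    moreover have "realizable N (\<lambda>u x. cis (\<Sum>T\<in>F. t T * Re (zs T x)) * u x)"
      using insert by simp
    ultimately have "realizable N (\<lambda>u x. cis (\<Sum>T\<in>F. t T * Re (zs T x)) * (cis (t T * Re (zs T x)) * u x))"
      by (rule realizable_comp)
    then show ?case using insert by (simp add: cis_mult add_ac flip: mult.assoc)
  qed
qed

text \<open>\<open>t\<close> is the Walsh transform of the arguments of the entries: by
  orthogonality of characters, the rotations by \<open>t T\<close> about Z on \<open>T\<close>
  multiply to the given diagonal.\<close>

lemma realizable_diag:
  assumes "\<And>x. cmod (d x) = 1"
  shows "realizable N (\<lambda>u x. d x * u x)"
proof -
  have finN: "finite N" by (simp add: N_def)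
  define t where "t T = (\<Sum>x\<in>Pow N. Arg (d x) * Re (zs T x)) / 2 ^ card N" for T
  have t: "(\<Sum>T\<in>Pow N. t T * Re (zs T y)) = Arg (d y)" if y: "y \<subseteq> N" for y
  proof -
    have orth: "(\<Sum>T\<in>Pow N. Re (zs T x) * Re (zs T y)) = (if x = y then 2 ^ card N else 0)"
      if x: "x \<subseteq> N" for x
    proof -
      have "(\<Sum>T\<in>Pow N. Re (zs T x) * Re (zs T y)) = Re (\<Sum>T\<in>Pow N. zs T (x \<ominus> y))"
        using x y finN finite_subset[OF x] finite_subset[OF y]
        by (simp add: Re_sum zs_sd_right Im_zs)
      also have "\<dots> = (if x = y then 2 ^ card N else 0)"
        using x y finN by (subst sum_zs) (auto simp: sd_def)
      finally show ?thesis .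
    qed
    have "(\<Sum>T\<in>Pow N. t T * Re (zs T y)) =
        (\<Sum>T\<in>Pow N. \<Sum>x\<in>Pow N. Arg (d x) / 2 ^ card N * (Re (zs T x) * Re (zs T y)))"
      unfolding t_def by (simp add: sum_distrib_left sum_divide_distrib mult_ac)
    also have "\<dots> = (\<Sum>x\<in>Pow N. Arg (d x) / 2 ^ card N * (\<Sum>T\<in>Pow N. Re (zs T x) * Re (zs T y)))"
      by (subst sum.swap) (simp add: sum_distrib_left)
    also have "\<dots> = (\<Sum>x\<in>Pow N. if x = y then Arg (d x) else 0)"
      by (intro sum.cong refl) (auto simp: orth)
    also have "\<dots> = Arg (d y)" using y finN by simp
    finally show ?thesis .
  qed
  have "realizable N (\<lambda>u x. cis (\<Sum>T\<in>Pow N. t T * Re (zs T x)) * u x)"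
    by (rule realizable_phases) simp
  then show ?thesis
  proof (rule realizable_cong)
    fix u assume u: "supported N u"
    show "(\<lambda>x. cis (\<Sum>T\<in>Pow N. t T * Re (zs T x)) * u x) = (\<lambda>x. d x * u x)"
    proof
      fix x
      have "cis (Arg (d x)) = d x"
        using assms[of x] by (subst cis_Arg) (auto simp: sgn_div_norm)
      then show "cis (\<Sum>T\<in>Pow N. t T * Re (zs T x)) * u x = d x * u x"
        using u t[of x] by (cases "x \<subseteq> N") (auto simp: supported_def)
    qed
  qed
qed

section \<open>Preparing a state qubit by qubit\<close>

definition hadamard :: "nat \<Rightarrow> nat qvec \<Rightarrow> nat qvec" where
  "hadamard k u = (\<lambda>x. if k \<in> x then u (x - {k}) - u x else u x + u (insert k x))"

text \<open>The unnormalised Hadamard gate is X(1 - ZX). The first rotation gives 1 - ZX, the second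
  gives \<i> X, and the scalar -\<i> removes the surplus factor.\<close>

lemma realizable_hadamard:
  assumes "k < n"
  shows "realizable N (hadamard k)"
proof -
  have "realizable N (rot 1 1 (-1) {k} {k})" "realizable N (rot \<i> 0 1 {k} {})"
    using rotatableD[OF rotatable_Y, of k 1 1 "-1"] rotatableD[OF rotatable_X, of k \<i> 0 1] assms
    by (auto simp: zs_singleton)
  then have "realizable N (\<lambda>u x. (- \<i>) * rot \<i> 0 1 {k} {} (rot 1 1 (-1) {k} {k} u) x)"
    using realizable_scale'[OF realizable_comp, where c = "- \<i>"] by simp
  then show ?thesis
  proof (rule realizable_cong)
    fix u show "(\<lambda>x. (- \<i>) * rot \<i> 0 1 {k} {} (rot 1 1 (-1) {k} {k} u) x) = hadamard k u"
      by (auto simp: fun_eq_iff rot_def W_def hadamard_def zs_singleton sd_def insert_absorb algebra_simps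
          simp flip: mult.assoc)
  qed
qed

text \<open>By induction the marginal magnitudes \<open>r\<close> are prepared on the first
  \<open>k\<close> qubits. Hadamard, diagonal, Hadamard on qubit \<open>k\<close> splits each
  \<open>r x\<close> into two amplitudes of the right moduli, and a last diagonal corrects the
  phases.\<close>

lemma reach_any_state:
  assumes "k \<le> n" "supported {..<k} \<chi>" "\<chi> \<noteq> (\<lambda>_. 0)"
  shows "\<exists>l. reach N l (\<lambda>x. if x = {} then 1 else 0) \<chi>"
  using assms
proof (induction k arbitrary: \<chi>)
  case 0
  then have \<chi>: "\<chi> = (\<lambda>x. \<chi> {} * (if x = {} then 1 else 0))" by (auto simp: supported_def)
  then have "\<chi> {} \<noteq> 0" using 0 by (metis (full_types) mult_zero_left)
  then show ?case using \<chi> by (metis reach_scale reach_refl)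
next
  case (Suc k)
  define r where "r x = (if x \<subseteq> {..<k} then sqrt ((cmod (\<chi> x))\<^sup>2 + (cmod (\<chi> (insert k x)))\<^sup>2) else 0)" for x
  \<comment> \<open>A unit number whose real and imaginary parts are the two relative moduli; |1 +
    z*z| = 2 |Re z| and |1 - z*z| = 2 |Im z|.\<close>
  define z where "z x = Complex (cmod (\<chi> x) / r x) (cmod (\<chi> (insert k x)) / r x)" for x
  \<comment> \<open>Where \<open>r\<close> vanishes, \<open>z\<close> is 0 by the convention on
    division, so the phase defaults to 1.\<close>
  define d where "d x = (if k \<in> x \<and> r (x - {k}) \<noteq> 0 then (z (x - {k}))\<^sup>2 else 1)" for x
  define u where "u = hadamard k (\<lambda>x. d x * hadamard k (\<lambda>x. of_real (r x)) x)"
  \<comment> \<open>The moduli of \<open>u\<close> and \<open>\<chi>\<close> agree up to the factor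
    2 from two unnormalised Hadamard gates, so this quotient is a phase.\<close>
  define d' where "d' x = (if u x = 0 then 1 else 2 * \<chi> x / u x)" for x
  have supr: "supported {..<k} (\<lambda>x. of_real (r x) :: complex)" by (simp add: supported_def r_def)
  have "\<exists>x. r x \<noteq> 0"
  proof -
    obtain x where "\<chi> x \<noteq> 0" using Suc.prems by auto
    moreover from this have "x \<subseteq> {..<Suc k}" using Suc.prems by (auto simp: supported_def)
    moreover from this have "x - {k} \<subseteq> {..<k}" by auto
    ultimately have "r (x - {k}) \<noteq> 0"
      by (cases "k \<in> x") (auto simp: r_def insert_absorb add_nonneg_eq_0_iff)
    then show ?thesis ..
  qed
  then have reach_r: "\<exists>l. reach N l (\<lambda>x. if x = {} then 1 else 0) (\<lambda>x. of_real (r x))"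
    using Suc.prems supr by (intro Suc.IH) (auto simp: fun_eq_iff)
  have "supported N (\<lambda>x. of_real (r x) :: complex)"
    by (rule supported_mono[OF _ supr]) (use Suc.prems in \<open>auto simp: N_def\<close>)
  have zz: "cmod (z x) = 1" "cmod (1 + (z x)\<^sup>2) = 2 * cmod (\<chi> x) / r x" 
    "cmod (1 - (z x)\<^sup>2) = 2 * cmod (\<chi> (insert k x)) / r x" if "r x \<noteq> 0" for x
  proof -
    have "r x = sqrt ((cmod (\<chi> x))\<^sup>2 + (cmod (\<chi> (insert k x)))\<^sup>2)" using that by (auto simp: r_def split: if_splits)
    then have r: "(r x)\<^sup>2 = (cmod (\<chi> x))\<^sup>2 + (cmod (\<chi> (insert k x)))\<^sup>2" "r x \<ge> 0" by simp_all
    show 1: "cmod (z x) = 1"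
      using that by (simp add: z_def complex_norm power_divide flip: add_divide_distrib r(1))
    then have "z x * cnj (z x) = 1" by (simp flip: complex_norm_square)
    then have "1 + (z x)\<^sup>2 = z x * (cnj (z x) + z x)" "1 - (z x)\<^sup>2 = z x * (cnj (z x) - z x)"
      by (simp_all add: algebra_simps power2_eq_square)
    moreover have "cnj (z x) + z x = of_real (2 * Re (z x))" "cnj (z x) - z x = - 2 * \<i> * of_real (Im (z x))"
      by (simp_all add: complex_eq_iff)
    ultimately have "cmod (1 + (z x)\<^sup>2) = 2 * \<bar>Re (z x)\<bar>" "cmod (1 - (z x)\<^sup>2) = 2 * \<bar>Im (z x)\<bar>"
      using 1 by (simp_all add: norm_mult del: of_real_mult)
    then show "cmod (1 + (z x)\<^sup>2) = 2 * cmod (\<chi> x) / r x" 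
      "cmod (1 - (z x)\<^sup>2) = 2 * cmod (\<chi> (insert k x)) / r x"
      using r by (simp_all add: z_def)
  qed
  have "cmod (d x) = 1" for x using zz(1) by (simp add: d_def norm_power)
  then have "realizable N (\<lambda>v x. d x * v x)" by (rule realizable_diag)
  moreover have "realizable N (hadamard k)" using Suc.prems realizable_hadamard by simp
  ultimately have opu: "realizable N (\<lambda>v. hadamard k (\<lambda>x. d x * hadamard k v x))"
    using realizable_comp[OF realizable_comp] by blast
  have u: "cmod (u y) = 2 * cmod (\<chi> y)" for y
  proof (cases "y - {k} \<subseteq> {..<k}")
    case True
    define x where "x = y - {k}"
    have x: "x \<subseteq> {..<k}" "k \<notin> x" "\<not> insert k x \<subseteq> {..<k}" using True by (auto simp: x_def)
    have y: "y = x \<or> y = insert k x" by (auto simp: x_def)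
    have rk: "r (insert k x) = 0" using x by (auto simp: r_def)
    have ux: "u x = r x * (1 + d (insert k x))" "u (insert k x) = r x * (1 - d (insert k x))"
      using x rk by (auto simp: u_def hadamard_def d_def insert_absorb algebra_simps)
    have d: "d (insert k x) = (if r x = 0 then 1 else (z x)\<^sup>2)" using x by (simp add: d_def)
    have "r x \<ge> 0" by (simp add: r_def)
    moreover have "\<chi> x = 0 \<and> \<chi> (insert k x) = 0" if "r x = 0"
      using that x by (auto simp: r_def add_nonneg_eq_0_iff)
    ultimately show ?thesis
      using y by (auto simp: ux d norm_mult zz)
  next
    case False
    then have "\<not> y \<subseteq> {..<Suc k}" by auto
    then have "\<chi> y = 0" using Suc.prems by (simp add: supported_def)
    moreover have "\<not> y \<subseteq> {..<k}" "\<not> insert k y \<subseteq> {..<k}" "\<not> y - {k} \<subseteq> {..<k}"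
      using False by auto
    ultimately show ?thesis by (simp add: u_def hadamard_def r_def)
  qed
  have "u x = 0 \<longleftrightarrow> \<chi> x = 0" for x using u[of x] by auto
  then have "cmod (d' x) = 1" and d'u: "d' x * u x = 2 * \<chi> x" for x
    using u[of x] by (auto simp: d'_def norm_divide norm_mult)
  then have "realizable N (\<lambda>v x. d' x * v x)" by (intro realizable_diag)
  then have "realizable N (\<lambda>v x. (1/2) * (d' x * hadamard k (\<lambda>x. d x * hadamard k v x) x))"
    by (rule realizable_scale'[OF realizable_comp[OF opu]]) simp
  then have "\<exists>l. reach N l (\<lambda>x. of_real (r x)) (\<lambda>x. (1/2) * (d' x * u x))"
    using \<open>supported N (\<lambda>x. of_real (r x))\<close> unfolding realizable_def u_def by blast
  then have "\<exists>l. reach N l (\<lambda>x. of_real (r x)) \<chi>"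
    by (simp add: d'u)
  then show ?case using reach_r reach_trans by blast
qed

text \<open>The first column of a cluster carries the uniform superposition, which is
  \<open>transfer\<close> of the zero configuration; undoing that gives the start of
  \<open>reach_any_state\<close>.\<close>

lemma reach_from_plus:
  assumes "supported N \<chi>" "\<chi> \<noteq> (\<lambda>_. 0)"
  shows "\<exists>l. reach N l (\<lambda>x. if x \<subseteq> N then 1 else 0) \<chi>"
proof -
  define \<delta> :: "nat qvec" where "\<delta> = (\<lambda>x. if x = {} then 1 else 0)"
  have "finite N" by (simp add: N_def)
  then obtain g where g: "realizable N g" "\<And>u. supported N u \<Longrightarrow> g (transfer N u) = u"
    using realizable_tr_inverse by metis
  have "cz \<delta> = \<delta>" by (auto simp: cz_def \<delta>_def edge_sign_def)
  moreover have "(\<Sum>x\<in>Pow N. zs x y * \<delta> x) = 1" for y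
    using \<open>finite N\<close> by (simp add: \<delta>_def if_distrib[of "(*) _"] cong: if_cong)
  ultimately have "transfer N \<delta> = (\<lambda>x. if x \<subseteq> N then 1 else 0)"
    by (simp add: transfer_def hadamard_all_def fun_eq_iff)
  moreover have "supported N \<delta>" by (auto simp: \<delta>_def supported_def)
  ultimately have "\<exists>l. reach N l (\<lambda>x. if x \<subseteq> N then 1 else 0) \<delta>"
    using g supported_transfer[of N \<delta>] unfolding realizable_def by metis
  then show ?thesis
    using reach_any_state[of n \<chi>] assms reach_trans unfolding \<delta>_def N_def by blast
qed

end

section \<open>Measuring the cluster state\<close>

text \<open>Measurement strategies on logical qubits, independent of any encoding. The two outcomes
  have separate derivations, which expresses adaptivity. Only values at subsets of \<open>V\<close>
  count, so outcome 0 of a Z measurement leaves \<open>v\<close> itself.\<close>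

inductive logically_steerable :: "('l set \<Rightarrow> 'l qvec \<Rightarrow> bool) \<Rightarrow> 'l set \<Rightarrow> 'l qvec \<Rightarrow> bool" for Q where
  logically_steerable_stop: "Q V v \<Longrightarrow> logically_steerable Q V v"
| logically_steerable_Z: "k \<in> V \<Longrightarrow> logically_steerable Q (V - {k}) v \<Longrightarrow> logically_steerable Q (V - {k}) (\<lambda>S. v (insert k S)) \<Longrightarrow> logically_steerable Q V v"
| logically_steerable_XY: "k \<in> V \<Longrightarrow> cmod \<omega> = 1 \<Longrightarrow> logically_steerable Q (V - {k}) (\<lambda>S. v S + \<omega> * v (insert k S)) \<Longrightarrow>
    logically_steerable Q (V - {k}) (\<lambda>S. v S - \<omega> * v (insert k S)) \<Longrightarrow> logically_steerable Q V v"

lemma Pow_insert_sum: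
  assumes "finite C" "k \<notin> C"
  shows "(\<Sum>x\<in>Pow (insert k C). f x) = (\<Sum>x\<in>Pow C. f x + f (insert k x))"
proof -
  have "(\<Sum>x\<in>Pow (insert k C). f x) = (\<Sum>x\<in>Pow C. f x) + (\<Sum>x\<in>insert k ` Pow C. f x)"
    unfolding Pow_insert using assms by (intro sum.union_disjoint) auto
  also have "(\<Sum>x\<in>insert k ` Pow C. f x) = (\<Sum>x\<in>Pow C. f (insert k x))"
    using assms by (intro sum.reindex_cong[of "insert k"]) (auto simp: inj_on_def insert_ident)
  finally show ?thesis by (simp add: sum.distrib)
qed

lemma zs_Un_disjoint:
  "finite A \<Longrightarrow> finite B \<Longrightarrow> A \<inter> B = {} \<Longrightarrow> zs C (A \<union> B) = zs C A * zs C B"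
  using zs_sd_right[of C A B] by (simp add: sd_disjoint)

lemma zs_insert:
  "finite x \<Longrightarrow> k \<notin> x \<Longrightarrow> zs s (insert k x) = (if k \<in> s then -1 else 1) * zs s x"
  using zs_Un_disjoint[of "{k}" x s] by (simp add: zs_singleton)

lemma zs_insert_left:
  "finite x \<Longrightarrow> k \<notin> x \<Longrightarrow> zs (insert k x) s = (if k \<in> s then -1 else 1) * zs x s"
  using zs_insert[of x k s] by (simp add: zs_commute)

text \<open>For measuring one whole column with phases fixed in advance. \<open>s\<close> collects
  the qubits with the minus outcome; they enter as Z signs.\<close>

lemma logically_steerable_XY_set:
  assumes "finite C" "C \<subseteq> V" "\<And>k. cmod (\<omega> k) = 1"
    "\<And>s. s \<subseteq> C \<Longrightarrow> logically_steerable Q (V - C) (\<lambda>S. \<Sum>x\<in>Pow C. (\<Prod>k\<in>x. \<omega> k) * zs s x * v (x \<union> S))"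
  shows "logically_steerable Q V v"
  using assms
proof (induction C arbitrary: V v rule: finite_induct)
  case empty
  then show ?case by simp
next
  case (insert k C)
  show ?case
  proof (rule insert.IH)
    fix s assume s: "s \<subseteq> C"
    have fin: "finite x" "k \<notin> x" "k \<notin> s" "finite s" if "x \<subseteq> C" for x 
      using that s insert.hyps(1,2) finite_subset by blast+
    have *: "(\<Sum>x\<in>Pow C. (\<Prod>k\<in>x. \<omega> k) * zs s x * v (x \<union> S)) + \<sigma> * (\<omega> k * (\<Sum>x\<in>Pow C. (\<Prod>k\<in>x. \<omega> k) * zs s x * v (x \<union> insert k S)))
      = (\<Sum>x\<in>Pow (insert k C). (\<Prod>k\<in>x. \<omega> k) * zs s' x * v (x \<union> S))"
      if "(\<sigma> = 1 \<and> s' = s) \<or> (\<sigma> = -1 \<and> s' = insert k s)" for S \<sigma> s'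
    proof -
      have "zs s' x = zs s x" "zs s' (insert k x) = \<sigma> * zs s x" if "x \<subseteq> C" for x
        using \<open>(\<sigma> = 1 \<and> s' = s) \<or> _\<close> fin[OF that] 
        by (auto simp: zs_insert zs_insert_left)
      moreover have "(\<Prod>k\<in>insert k x. \<omega> k) = \<omega> k * (\<Prod>k\<in>x. \<omega> k)" if "x \<subseteq> C" for x
        using fin[OF that] by simp
      ultimately show ?thesis
        unfolding Pow_insert_sum[OF insert.hyps(1,2)] sum_distrib_left sum.distrib[symmetric]
        by (intro sum.cong refl) (simp add: mult_ac)
    qed
    have V: "V - insert k C = V - C - {k}" by auto
    show "logically_steerable Q (V - C) (\<lambda>S. \<Sum>x\<in>Pow C. (\<Prod>k\<in>x. \<omega> k) * zs s x * v (x \<union> S))"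
    proof (rule logically_steerable_XY[of k _ "\<omega> k"])
      show "logically_steerable Q (V - C - {k}) (\<lambda>S. (\<Sum>x\<in>Pow C. (\<Prod>k\<in>x. \<omega> k) * zs s x * v (x \<union> S)) +
          \<omega> k * (\<Sum>x\<in>Pow C. (\<Prod>k\<in>x. \<omega> k) * zs s x * v (x \<union> insert k S)))"
        using insert.prems(3)[of s] s *[of 1 s] unfolding V by (simp add: subset_insertI2)
      show "logically_steerable Q (V - C - {k}) (\<lambda>S. (\<Sum>x\<in>Pow C. (\<Prod>k\<in>x. \<omega> k) * zs s x * v (x \<union> S)) -
          \<omega> k * (\<Sum>x\<in>Pow C. (\<Prod>k\<in>x. \<omega> k) * zs s x * v (x \<union> insert k S)))"
        using insert.prems(3)[of "insert k s"] s *[of "-1" "insert k s"] unfolding V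
        by (simp add: subset_insertI2)
    qed (use insert.hyps insert.prems(1,2) in auto)
  qed (use insert.prems(1,2) in auto)
qed

section \<open>Graph states of the grid and deletion of vertices\<close>

definition up :: "nat \<times> nat \<Rightarrow> nat \<times> nat" where "up = (\<lambda>(r, c). (Suc r, c))"
definition right :: "nat \<times> nat \<Rightarrow> nat \<times> nat" where "right = (\<lambda>(r, c). (r, Suc c))"

lemma inj_up: "inj up" and inj_right: "inj right"
  by (auto simp: inj_def up_def right_def)

text \<open>Amplitude of the graph state of the infinite quarter-plane grid, one sign per edge
  inside \<open>S\<close>. Restricted to subsets of \<open>V\<close> it describes the induced
  subgraph, so a single function serves all regions.\<close>

definition grid_sign :: "(nat \<times> nat) set \<Rightarrow> complex" where
  "grid_sign S = edge_sign up S * edge_sign right S"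

definition grid_nb :: "(nat \<times> nat) set \<Rightarrow> (nat \<times> nat) set" where
  "grid_nb A = (up ` A \<ominus> up -` A) \<ominus> (right ` A \<ominus> right -` A)"

lemma finite_grid_nb [simp]: "finite A \<Longrightarrow> finite (grid_nb A)"
  by (simp add: grid_nb_def finite_vimageI inj_up inj_right)

lemma grid_sign_sd:
  "finite S \<Longrightarrow> finite A \<Longrightarrow> grid_sign (S \<ominus> A) = grid_sign S * grid_sign A * zs (grid_nb A) S"
  by (simp add: grid_sign_def grid_nb_def edge_sign_sd inj_up inj_right zs_sd_left mult_ac)

lemma grid_sign_empty [simp]: "grid_sign {} = 1"
  by (simp add: grid_sign_def edge_sign_def)

lemma grid_sign_singleton [simp]: "grid_sign {a} = 1"
  by (auto simp: grid_sign_def edge_sign_def zs_singleton up_def right_def split: prod.splits)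

lemma grid_sign_insert:
  "finite S \<Longrightarrow> a \<notin> S \<Longrightarrow> grid_sign (insert a S) = grid_sign S * zs (grid_nb {a}) S"
  using grid_sign_sd[of S "{a}"] by (simp add: sd_insert)

lemma zs_slice: "zs B (x \<times> {j}) = zs {r. (r, j) \<in> B} x" "zs (x \<times> {j}) B = zs x {r. (r, j) \<in> B}"
proof -
  have "B \<inter> (x \<times> {j}) = ({r. (r, j) \<in> B} \<inter> x) \<times> {j}" by auto
  then show "zs B (x \<times> {j}) = zs {r. (r, j) \<in> B} x" by (simp add: zs_def card_cartesian_product)
  then show "zs (x \<times> {j}) B = zs x {r. (r, j) \<in> B}" by (simp add: zs_commute)
qed

lemma grid_sign_column:
  assumes "finite x" "finite S" "S \<subseteq> UNIV \<times> {Suc j..}"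
  shows "grid_sign (x \<times> {j} \<union> S) = edge_sign Suc x * zs x {r. (r, Suc j) \<in> S} * grid_sign S"
proof -
  have "x \<times> {j} \<union> S = S \<ominus> x \<times> {j}" using assms by (subst sd_disjoint) auto
  then have "grid_sign (x \<times> {j} \<union> S) = grid_sign S * grid_sign (x \<times> {j}) * zs (grid_nb (x \<times> {j})) S"
    using assms by (simp add: grid_sign_sd)
  also have "grid_sign (x \<times> {j}) = edge_sign Suc x"
  proof -
    have "up ` (x \<times> {j}) = Suc ` x \<times> {j}" by (auto simp: up_def image_iff)
    moreover have "{r. (r, j) \<in> right ` (x \<times> {j})} = {}" by (auto simp: right_def)
    ultimately show ?thesis by (simp add: grid_sign_def edge_sign_def zs_slice)
  qed
  also have "zs (grid_nb (x \<times> {j})) S = zs x {r. (r, Suc j) \<in> S}"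
  proof -
    have "up ` (x \<times> {j}) \<inter> S = {}" "up -` (x \<times> {j}) \<inter> S = {}" "right -` (x \<times> {j}) \<inter> S = {}"
      using assms by (auto simp: up_def right_def split: prod.splits)
    moreover have "right ` (x \<times> {j}) = x \<times> {Suc j}" by (auto simp: right_def image_iff)
    ultimately show ?thesis
      using assms by (simp add: grid_nb_def zs_sd_left zs_disjoint zs_slice)
  qed
  finally show ?thesis by (simp add: mult_ac)
qed

definition grid_state :: "(nat \<times> nat) set \<Rightarrow> (nat \<times> nat) qvec \<Rightarrow> bool" where
  "grid_state V v \<longleftrightarrow> (\<exists>c B. finite B \<and> (\<forall>S\<subseteq>V. v S = c * zs B S * grid_sign S))"

text \<open>Measuring Z on a graph state deletes the vertex; outcome 1 leaves Z byproducts on its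
  neighbours.\<close>

lemma grid_state_delete:
  assumes "finite V" "grid_state V v" "k \<in> V"
  shows "grid_state (V - {k}) v" "grid_state (V - {k}) (\<lambda>S. v (insert k S))"
proof -
  obtain c B where B: "finite B" "\<And>S. S \<subseteq> V \<Longrightarrow> v S = c * zs B S * grid_sign S"
    using assms by (auto simp: grid_state_def)
  have "v S = c * zs B S * grid_sign S" if "S \<subseteq> V - {k}" for S using that B(2)[of S] by auto
  then show "grid_state (V - {k}) v" unfolding grid_state_def using B(1) by auto
  show "grid_state (V - {k}) (\<lambda>S. v (insert k S))"
    unfolding grid_state_def
  proof (intro exI conjI allI impI)
    show "finite (B \<ominus> grid_nb {k})" using B by simp
    fix S assume S: "S \<subseteq> V - {k}"
    then have "k \<notin> S" by auto
    have "finite S" by (rule finite_subset[OF S]) (use assms in simp)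
    then have "zs B (insert k S) = zs B S * zs B {k}"
      using \<open>k \<notin> S\<close> by (simp add: zs_insert zs_singleton)
    moreover have "v (insert k S) = c * zs B (insert k S) * grid_sign (insert k S)"
      using S assms by (intro B(2)) auto
    ultimately show "v (insert k S) = (c * zs B {k}) * zs (B \<ominus> grid_nb {k}) S * grid_sign S"
      using \<open>finite S\<close> \<open>k \<notin> S\<close> by (simp add: grid_sign_insert zs_sd_left mult_ac)
  qed
qed

lemma logically_steerable_grid_restrict:
  assumes "finite V" "V' \<subseteq> V" "grid_state V v" "\<And>v. grid_state V' v \<Longrightarrow> logically_steerable Q V' v"
  shows "logically_steerable Q V v"
proof -
  have "finite (V - V')" using assms by simp
  then show ?thesis using assms
  proof (induction "V - V'" arbitrary: V v rule: finite_induct)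
    case empty
    then have "V = V'" by auto
    then show ?case using empty by simp
  next
    case (insert k C)
    then have k: "k \<in> V" "k \<notin> V'" "C = (V - {k}) - V'" by auto
    show ?case
      by (rule logically_steerable_Z[OF k(1)]; rule insert.hyps(3))
        (use k insert.prems grid_state_delete in auto)
  qed
qed

section \<open>Measuring the grid column by column\<close>

context
  fixes n L :: nat and N :: "nat set" and V :: "nat \<Rightarrow> (nat \<times> nat) set"
    and Q :: "(nat \<times> nat) set \<Rightarrow> (nat \<times> nat) qvec \<Rightarrow> bool"
  defines "N \<equiv> {..<n}" and "V \<equiv> \<lambda>j. N \<times> {j..L}"
begin

text \<open>Columns \<open>< j\<close> are already measured and \<open>u\<close> is the ideal input at column \<open>j\<close>; the actual
  input differs by the Pauli operator \<open>W A B\<close>, and \<open>B'\<close> collects byproducts on later columns.\<close>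

definition solvable :: "nat \<Rightarrow> nat qvec \<Rightarrow> bool" where
  "solvable j u \<longleftrightarrow> (\<forall>v c A B B'. A \<subseteq> N \<longrightarrow> B \<subseteq> N \<longrightarrow> finite B' \<longrightarrow>
     (\<forall>S\<subseteq>V j. v S = c * zs B' S * grid_sign S * W A B u {r. (r, j) \<in> S}) \<longrightarrow> logically_steerable Q (V j) v)"

lemma solvable_scale: "c \<noteq> 0 \<Longrightarrow> solvable j (\<lambda>x. c * u x) \<Longrightarrow> solvable j u"
  unfolding solvable_def W_scale
proof (intro allI impI)
  fix v d A B B'
  assume c: "c \<noteq> 0" and *: "\<forall>v ca A B B'. A \<subseteq> N \<longrightarrow> B \<subseteq> N \<longrightarrow> finite B' \<longrightarrow>
     (\<forall>S\<subseteq>V j. v S = ca * zs B' S * grid_sign S * (c * W A B u {r. (r, j) \<in> S})) \<longrightarrow> logically_steerable Q (V j) v"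
    and A: "A \<subseteq> N" "B \<subseteq> N" "finite B'"
    and v: "\<forall>S\<subseteq>V j. v S = d * zs B' S * grid_sign S * W A B u {r. (r, j) \<in> S}"
  show "logically_steerable Q (V j) v"
    by (rule *[rule_format, OF A, of _ "d / c"]) (use c v in auto)
qed

text \<open>An X byproduct at \<open>k\<close> exchanges the two branches of the phase. The
  conjugate phase then acts, up to a global factor, as the intended one applied before the
  byproduct.\<close>

lemma phase_shift_W:
  assumes "cmod \<omega> = 1"
  shows "phase_shift k (if k \<in> A then cnj \<omega> else \<omega>) (W A B u) =
    (\<lambda>x. (if k \<in> A then cnj \<omega> else 1) * W A B (phase_shift k \<omega> u) x)"
proof -
  have "cnj \<omega> * (\<omega> * z) = z" for z
    using assms by (metis complex_norm_square mult.assoc mult.commute mult_1 of_real_1 one_power2)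
  then show ?thesis
    by (auto simp: phase_shift_def W_def sd_def fun_eq_iff mult_ac)
qed

text \<open>Summing over the content of column \<open>j\<close>, its vertical edges act as
  \<open>cz\<close> and its edges to the next column as the Hadamard kernel, so the residual state
  again has the form required by \<open>solvable\<close>, one column further on.\<close>

lemma solvable_step:
  assumes u: "supported N u" and j: "j < L" and \<omega>: "cmod \<omega> = 1"
    and nxt: "solvable (Suc j) (transfer N (phase_shift k \<omega> u))"
  shows "solvable j u"
  unfolding solvable_def
proof (intro allI impI)
  fix v c A B B'
  assume A: "A \<subseteq> N" "B \<subseteq> N" "finite B'"
    and v: "\<forall>S\<subseteq>V j. v S = c * zs B' S * grid_sign S * W A B u {r. (r, j) \<in> S}"
  have finN: "finite N" by (simp add: N_def)
  define \<omega>' where "\<omega>' = (if k \<in> A then cnj \<omega> else \<omega>)"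
  define w where "w q = (if q = (k, j) then \<omega>' else 1)" for q
  define C where "C = N \<times> {j}"
  have VC: "V j - C = V (Suc j)" by (auto simp: V_def C_def)
  show "logically_steerable Q (V j) v"
  proof (rule logically_steerable_XY_set[of C _ w])
    show "finite C" "C \<subseteq> V j" using j by (auto simp: C_def V_def N_def)
    show "cmod (w q) = 1" for q using \<omega> by (simp add: w_def \<omega>'_def)
    fix s assume s: "s \<subseteq> C"
    \<comment> \<open>Outcomes of this column and byproducts stored for it both act as Z signs in
      front of \<open>transfer\<close>.\<close>
    define b where "b = {r. (r, j) \<in> s} \<ominus> {r. (r, j) \<in> B'}"
    have "finite s" using s finN finite_subset by (auto simp: C_def)
    then have finb: "finite {r. (r, j) \<in> s}" "finite {r. (r, j) \<in> B'}"
      using A finite_vimageI[of _ "\<lambda>r. (r, j)"] by (auto simp: inj_def vimage_def)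
    then have "finite b" by (simp add: b_def)
    define z where "z = phase_shift k \<omega> u"
    define c1 where "c1 = (if k \<in> A then cnj \<omega> else 1)"
    have z: "supported N z" using u by (simp add: z_def phase_shift_def supported_def)
    obtain A2 B2 where 2: "transfer_label N (A, b \<ominus> B) = (A2, B2)" by fastforce
    then have AB2: "A2 \<subseteq> N" "B2 \<subseteq> N" using transfer_label_in[OF A(1), of "b \<ominus> B"] by auto
    have finB: "finite B" using A finN finite_subset by blast
    then have "finite (b \<ominus> B)" using \<open>finite b\<close> by simp
    from transfer_W[OF finN A(1) this 2] obtain c2 where
      c2: "transfer N (W A (b \<ominus> B) z) = (\<lambda>x. c2 * W A2 B2 (transfer N z) x)" using z by blast
    have "transfer N (W {} b (phase_shift k \<omega>' (W A B u))) = transfer N (\<lambda>x. c1 * W A (b \<ominus> B) z x)"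
      unfolding \<omega>'_def phase_shift_W[OF \<omega>] W_scale using W_W[of b B "{}" A] \<open>finite b\<close> finB
      by (simp add: z_def c1_def)
    then have transfer_eq: "transfer N (W {} b (phase_shift k \<omega>' (W A B u))) = (\<lambda>x. c1 * c2 * W A2 B2 (transfer N z) x)"
      by (simp add: transfer_scale c2 mult_ac)
    show "logically_steerable Q (V j - C) (\<lambda>S. \<Sum>x\<in>Pow C. (\<Prod>q\<in>x. w q) * zs s x * v (x \<union> S))"
      unfolding VC
    proof (rule nxt[unfolded solvable_def, rule_format, OF AB2 A(3)])
      fix S assume S: "S \<subseteq> V (Suc j)"
      \<comment> \<open>The content of the next column is the output variable of
        \<open>transfer\<close>.\<close>
      define y where "y = {r. (r, Suc j) \<in> S}"
      have y: "y \<subseteq> N" using S by (auto simp: y_def V_def)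
      have S': "S \<subseteq> UNIV \<times> {Suc j..}" using S by (auto simp: V_def)
      have finS: "finite S" using S finN finite_subset by (auto simp: V_def)
      have slice: "fst ` a \<times> {j} = a" if "a \<in> Pow C" for a using that by (force simp: C_def)
      have "(\<Sum>x\<in>Pow C. (\<Prod>q\<in>x. w q) * zs s x * v (x \<union> S)) =
        (\<Sum>x\<in>Pow N. (\<Prod>q\<in>x \<times> {j}. w q) * zs s (x \<times> {j}) * v (x \<times> {j} \<union> S))"
        by (rule sum.reindex_bij_witness[of _ "\<lambda>x. x \<times> {j}" "\<lambda>x. fst ` x"])
          (use slice in \<open>auto simp: C_def\<close>)
      also have "\<dots> = (\<Sum>x\<in>Pow N. c * zs B' S * grid_sign S * (zs x y * cz (W {} b (phase_shift k \<omega>' (W A B u))) x))"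
      proof (rule sum.cong[OF refl])
        fix x assume "x \<in> Pow N"
        then have x: "x \<subseteq> N" "finite x" using finN finite_subset by auto
        have "(\<Prod>q\<in>x \<times> {j}. w q) = (\<Prod>r\<in>x. if r = k then \<omega>' else 1)"
          by (intro prod.reindex_cong[of "\<lambda>r. (r, j)"]) (auto simp: w_def inj_on_def)
        also have "\<dots> = (if k \<in> x then \<omega>' else 1)" using x by simp
        finally have 1: "(\<Prod>q\<in>x \<times> {j}. w q) = (if k \<in> x then \<omega>' else 1)" .
        have "x \<times> {j} \<inter> S = {}" using S' by auto
        then have "zs B' (x \<times> {j} \<union> S) = zs B' (x \<times> {j}) * zs B' S"
          using finS x by (simp add: zs_Un_disjoint)
        moreover have "{r. (r, j) \<in> x \<times> {j} \<union> S} = x" using S' by auto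
        moreover have "x \<times> {j} \<union> S \<subseteq> V j" using x S j by (auto simp: V_def)
        ultimately have 3: "v (x \<times> {j} \<union> S) = c * (zs {r. (r, j) \<in> B'} x * zs B' S) *
            (edge_sign Suc x * zs x y * grid_sign S) * W A B u x"
          using v grid_sign_column[OF x(2) finS S'] by (simp add: zs_slice y_def)
        have 4: "zs b x = zs {r. (r, j) \<in> s} x * zs {r. (r, j) \<in> B'} x"
          using x finb by (simp add: b_def zs_sd_left)
        show "(\<Prod>q\<in>x \<times> {j}. w q) * zs s (x \<times> {j}) * v (x \<times> {j} \<union> S) =
          c * zs B' S * grid_sign S * (zs x y * cz (W {} b (phase_shift k \<omega>' (W A B u))) x)"
          unfolding 1 3 zs_slice by (simp add: cz_def W_def[of "{}"] phase_shift_def 4 mult_ac)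
      qed
      also have "\<dots> = c * zs B' S * grid_sign S * transfer N (W {} b (phase_shift k \<omega>' (W A B u))) y"
        using y by (simp add: transfer_def hadamard_all_def sum_distrib_left)
      finally show "(\<Sum>x\<in>Pow C. (\<Prod>q\<in>x. w q) * zs s x * v (x \<union> S)) =
         (c * c1 * c2) * zs B' S * grid_sign S * W A2 B2 (transfer N (phase_shift k \<omega> u)) {r. (r, Suc j) \<in> S}"
        unfolding transfer_eq y_def z_def by (simp add: mult_ac)
    qed
  qed
qed

text \<open>The vertical edges of the unmeasured column \<open>L\<close> still act as
  \<open>cz\<close> and cancel the one in \<open>cz \<phi>\<close>; the byproducts pass through by
  \<open>cz_W\<close>.\<close>

lemma solvable_last:
  assumes \<phi>: "supported N \<phi>"
    and Q: "\<And>v c A B. A \<subseteq> N \<Longrightarrow> B \<subseteq> N \<Longrightarrow> (\<And>x. x \<subseteq> N \<Longrightarrow> v (x \<times> {L}) = c * W A B \<phi> x) \<Longrightarrow> Q (N \<times> {L}) v"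
  shows "solvable L (cz \<phi>)"
  unfolding solvable_def
proof (intro allI impI)
  fix v c A B B'
  assume A: "A \<subseteq> N" "B \<subseteq> N" "finite B'"
    and v: "\<forall>S\<subseteq>V L. v S = c * zs B' S * grid_sign S * W A B (cz \<phi>) {r. (r, L) \<in> S}"
  define b where "b = {r. (r, L) \<in> B'}"
  have finN: "finite N" by (simp add: N_def)
  then have fin: "finite A" "finite B" using A finite_subset by blast+
  have finb: "finite b"
    using A finite_vimageI[of _ "\<lambda>r. (r, L)"] by (auto simp: inj_def vimage_def b_def)
  define B2 where "B2 = (b \<ominus> (B \<ominus> nb A)) \<inter> N"
  have "Q (N \<times> {L}) v"
  proof (rule Q[OF A(1)])
    show "B2 \<subseteq> N" by (simp add: B2_def)
    fix x assume x: "x \<subseteq> N"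
    then have "finite x" using finN finite_subset by blast
    have "x \<times> {L} \<subseteq> V L" using x by (auto simp: V_def)
    then have "v (x \<times> {L}) = c * zs b x * edge_sign Suc x * W A B (cz \<phi>) x"
      using v grid_sign_column[OF \<open>finite x\<close>, of "{}" L] by (simp add: zs_slice b_def)
    also have "\<dots> = c * W {} b (cz (W A B (cz \<phi>))) x" by (simp add: cz_def W_def[of "{}"])
    also have "cz (W A B (cz \<phi>)) = (\<lambda>x. edge_sign Suc A * W A (B \<ominus> nb A) \<phi> x)"
      using cz_W[OF finN A(1) fin(2), of "cz \<phi>"] \<phi> by simp
    also have "W {} b \<dots> = (\<lambda>x. edge_sign Suc A * W A B2 \<phi> x)"
      unfolding W_scale using W_W[of b "B \<ominus> nb A" "{}" A] fin finb A \<phi>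
      by (simp add: B2_def W_Int)
    finally show "v (x \<times> {L}) = (c * edge_sign Suc A) * W A B2 \<phi> x" by simp
  qed
  moreover have "V L = N \<times> {L}" by (simp add: V_def)
  ultimately show "logically_steerable Q (V L) v" by (simp add: logically_steerable_stop)
qed

lemma solvable_reach:
  assumes "reach N l u \<chi>" "solvable L \<chi>" "supported N u" "j + l = L"
  shows "solvable j u"
  using assms
proof (induction arbitrary: j rule: reach.induct)
  case (reach_refl u)
  then show ?case by simp
next
  case (reach_scale c l u v)
  have "supported N (\<lambda>x. c * u x)" using reach_scale.prems(2) by (simp add: supported_def)
  then have "solvable j (\<lambda>x. c * u x)"
    using reach_scale.IH reach_scale.prems by blast
  then show ?case by (rule solvable_scale[OF reach_scale.hyps(1)])
next
  case (reach_step \<omega> l k u v)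
  have "solvable (Suc j) (transfer N (phase_shift k \<omega> u))"
    using reach_step.prems by (intro reach_step.IH) auto
  moreover have "j < L" using reach_step.prems by simp
  ultimately show ?case
    using solvable_step[OF reach_step.prems(2) _ reach_step.hyps(1)] by blast
qed

end

text \<open>\<open>L\<close> is obtained before \<open>d\<close>, \<open>v\<close> and
  \<open>Q\<close>: the output column is the same whatever byproducts the cluster state comes
  with.\<close>

lemma logically_steerable_grid:
  assumes "supported {..<n} \<phi>" "\<phi> \<noteq> (\<lambda>_. 0)"
  obtains L where "\<And>d v Q. n \<le> d \<Longrightarrow> L < d \<Longrightarrow> grid_state ({..<d} \<times> {..<d}) v \<Longrightarrow>
    (\<And>v c A B. A \<subseteq> {..<n} \<Longrightarrow> B \<subseteq> {..<n} \<Longrightarrow>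
      (\<And>x. x \<subseteq> {..<n} \<Longrightarrow> v (x \<times> {L}) = c * W A B \<phi> x) \<Longrightarrow> Q ({..<n} \<times> {L}) v) \<Longrightarrow>
    logically_steerable Q ({..<d} \<times> {..<d}) v"
proof -
  have "cz \<phi> \<noteq> (\<lambda>_. 0)" using assms(2) by (metis cz_twice cz_def mult_zero_right)
  then obtain L where L: "reach {..<n} L (\<lambda>x. if x \<subseteq> {..<n} then 1 else 0) (cz \<phi>)"
    using reach_from_plus[of n "cz \<phi>"] assms(1) by auto
  show ?thesis
  proof (rule that[of L])
    fix d v Q
    assume d: "n \<le> d" "L < d" "grid_state ({..<d} \<times> {..<d}) v" and Q: "\<And>v c A B. A \<subseteq> {..<n} \<Longrightarrow> B \<subseteq> {..<n} \<Longrightarrow>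
      (\<And>x. x \<subseteq> {..<n} \<Longrightarrow> v (x \<times> {L}) = c * W A B \<phi> x) \<Longrightarrow> Q ({..<n} \<times> {L}) v"
    have "solvable n L Q L (cz \<phi>)" by (rule solvable_last[OF assms(1)]) (rule Q)
    then have "solvable n L Q 0 (\<lambda>x. if x \<subseteq> {..<n} then 1 else 0)"
      using solvable_reach[OF L, of L Q 0] by (simp add: supported_def)
    then have sol: "logically_steerable Q ({..<n} \<times> {0..L}) v" if "finite B" "\<forall>S\<subseteq>{..<n} \<times> {0..L}. v S = c * zs B S * grid_sign S *
      W {} {} (\<lambda>x. if x \<subseteq> {..<n} then 1 else 0) {r. (r, 0) \<in> S}" for v c B
      using that unfolding solvable_def by blast
    show "logically_steerable Q ({..<d} \<times> {..<d}) v"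
    proof (rule logically_steerable_grid_restrict[OF _ _ d(3)])
      show "{..<n} \<times> {0..L} \<subseteq> {..<d} \<times> {..<d}" using d by auto
      fix v assume "grid_state ({..<n} \<times> {0..L}) v"
      then obtain c B where B: "finite B" "\<forall>S\<subseteq>{..<n} \<times> {0..L}. v S = c * zs B S * grid_sign S"
        unfolding grid_state_def by blast
      have "{r. (r, 0) \<in> S} \<subseteq> {..<n}" if "S \<subseteq> {..<n} \<times> {0..L}" for S using that by auto
      then show "logically_steerable Q ({..<n} \<times> {0..L}) v"
        using B by (intro sol[of B _ c]) auto
    qed simp
  qed
qed

section \<open>LOCC discrimination of orthogonal states\<close>

text \<open>A protocol seen through the tree of its states, so that strategies can be composed
  without handling protocol terms. The zero vector is a branch of probability zero and has to meet
  no goal.\<close>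

inductive steerable :: "'q set \<Rightarrow> ('q qvec \<Rightarrow> bool) \<Rightarrow> 'q qvec \<Rightarrow> bool" for E Q where
  steerable_stop: "(w \<noteq> (\<lambda>_. 0) \<Longrightarrow> Q w) \<Longrightarrow> steerable E Q w"
| steerable_meas: "a \<in> E \<Longrightarrow> kraus_complete Ks \<Longrightarrow> \<forall>K\<in>set Ks. steerable E Q (apply1 K a w) \<Longrightarrow> steerable E Q w"

lemma steerable_protocol:
  "steerable E Q w \<Longrightarrow> \<exists>pr. locc_wf E pr \<and> (\<forall>w'. locc_branch pr w w' \<and> w' \<noteq> (\<lambda>_. 0) \<longrightarrow> Q w')"
proof (induction rule: steerable.induct)
  case (steerable_stop w)
  have "w' = w" if "locc_branch Stop w w'" for w' using that by cases
  then show ?case using steerable_stop by (intro exI[of _ Stop]) (auto intro: locc_wf.intros)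
next
  case (steerable_meas a Ks w)
  then obtain f where f: "\<And>K. K \<in> set Ks \<Longrightarrow> locc_wf E (f K)"
    "\<And>K w'. K \<in> set Ks \<Longrightarrow> locc_branch (f K) (apply1 K a w) w' \<Longrightarrow> w' \<noteq> (\<lambda>_. 0) \<Longrightarrow> Q w'"
    by metis
  define ks where "ks = map (\<lambda>K. (K, f K)) Ks"
  have "map fst ks = Ks" by (simp add: ks_def comp_def)
  then have "locc_wf E (Meas a ks)"
    using steerable_meas.hyps f(1) by (intro locc_wf.intros) (auto simp: ks_def)
  moreover have "Q w'" if "locc_branch (Meas a ks) w w'" "w' \<noteq> (\<lambda>_. 0)" for w'
    using that(1) by cases (use f(2) that(2) in \<open>auto simp: ks_def\<close>)
  ultimately show ?case by blast
qed

lemma protocol_steerable: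
  assumes "locc_wf E pr" "\<And>w'. locc_branch pr w w' \<Longrightarrow> w' \<noteq> (\<lambda>_. 0) \<Longrightarrow> Q w'"
  shows "steerable E Q w"
  using assms
proof (induction arbitrary: w rule: locc_wf.induct)
  case 1
  then show ?case by (intro steerable_stop) (auto intro: locc_branch.intros)
next
  case (2 a ks)
  show ?case
  proof (rule steerable_meas[OF 2(1,2)], rule ballI)
    fix K assume "K \<in> set (map fst ks)"
    then obtain pr where pr: "(K, pr) \<in> set ks" by auto
    then have "\<And>w'. locc_branch pr (apply1 K a w) w' \<Longrightarrow> w' \<noteq> (\<lambda>_. 0) \<Longrightarrow> Q w'"
      using 2(4) locc_branch.intros(2) by metis
    then show "steerable E Q (apply1 K a w)" using 2(3) pr by fastforce
  qed
qed

lemma steerable_trans: "steerable E Q w \<Longrightarrow> (\<And>w. Q w \<Longrightarrow> steerable E R w) \<Longrightarrow> steerable E R w"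
proof (induction rule: steerable.induct)
  case (steerable_stop w)
  show ?case
  proof (cases "w = (\<lambda>_. 0)")
    case True then show ?thesis by (intro steerable.steerable_stop) auto
  next
    case False then show ?thesis using steerable_stop by blast
  qed
next
  case (steerable_meas a Ks w)
  then show ?case by (intro steerable.steerable_meas) auto
qed

section \<open>Isotropic vectors and destructive discrimination\<close>

lemma traceless_isotropic:
  fixes M00 M01 M10 M11 :: complex
  assumes "M00 + M11 = 0"
  shows "\<exists>e0 e1. e0 * cnj e0 + e1 * cnj e1 = 1 \<and>
    e0 * cnj e0 * M00 + e0 * cnj e1 * M01 + e1 * cnj e0 * M10 + e1 * cnj e1 * M11 = 0"
proof (cases "M00 = 0")
  case True
  then show ?thesis using assms by (intro exI[of _ 1] exI[of _ 0]) auto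
next
  case False
  define b c where "b = M01 / M00" and "c = M10 / M00"
  \<comment> \<open>This is \<open>b - cnj c\<close>. A unit \<open>z\<close> in its direction makes
    \<open>cnj z * b + z * c\<close> real.\<close>
  define d where "d = Complex (Re b - Re c) (Im b + Im c)"
  define z where "z = (if d = 0 then 1 else sgn d)"
  define \<rho> where "\<rho> = Re (cnj z * b + z * c)"
  have "cmod z = 1" by (simp add: z_def norm_sgn)
  then have z: "z * cnj z = 1" by (simp flip: complex_norm_square)
  have "Im (cnj z * b + z * c) = 0"
  proof (cases "d = 0")
    case True then show ?thesis by (simp add: z_def d_def complex_eq_iff)
  next
    case False
    then have "cmod d *\<^sub>R z = d" by (simp add: z_def sgn_div_norm)
    then have "cmod d * Re z = Re d" "cmod d * Im z = Im d"
      by (metis scaleR_complex.sel)+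
    have "cmod d * Im (cnj z * b + z * c) =
      (cmod d * Re z) * (Im b + Im c) - (cmod d * Im z) * (Re b - Re c)"
      by (simp add: algebra_simps)
    also have "\<dots> = 0"
      unfolding \<open>cmod d * Re z = Re d\<close> \<open>cmod d * Im z = Im d\<close> by (simp add: d_def)
    finally show ?thesis using False by simp
  qed
  then have \<rho>: "cnj z * b + z * c = of_real \<rho>" by (simp add: \<rho>_def complex_eq_iff)
  \<comment> \<open>A root of q*q - \<rho> q - 1 = 0: at the vector s(1, q z) the form equals s*s*(1
    + q \<rho> - q*q) times \<open>M00\<close>, and \<open>s\<close> normalises.\<close>
  define q where "q = (\<rho> + sqrt (\<rho>\<^sup>2 + 4)) / 2"
  have "(sqrt (\<rho>\<^sup>2 + 4))\<^sup>2 = \<rho>\<^sup>2 + 4" by simp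
  then have q: "1 - q * q + q * \<rho> = 0"
    by (simp add: q_def power2_eq_square field_simps)
  define s where "s = 1 / sqrt (1 + q * q)"
  have s: "s * s * (1 + q * q) = 1"
    by (simp add: s_def add_nonneg_eq_0_iff)
  show ?thesis
  proof (intro exI conjI)
    have "of_real s * cnj (of_real s) + of_real (s * q) * z * cnj (of_real (s * q) * z) =
      of_real (s * s * (1 + q * q * 1)) + of_real (s * s * q * q) * (z * cnj z - 1)"
      by (simp add: algebra_simps)
    then show "of_real s * cnj (of_real s) + (of_real (s * q) * z) * cnj (of_real (s * q) * z) = 1"
      using s z by simp
    have "of_real s * cnj (of_real s) * M00 + of_real s * cnj (of_real (s * q) * z) * M01 +
      (of_real (s * q) * z) * cnj (of_real s) * M10 + (of_real (s * q) * z) * cnj (of_real (s * q) * z) * M11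
      = of_real (s * s) * (M00 + of_real q * (cnj z * M01 + z * M10) + of_real (q * q) * ((z * cnj z) * M11))"
      by (simp add: algebra_simps)
    moreover have "cnj z * M01 + z * M10 = M00 * of_real \<rho>"
      using False by (simp add: b_def c_def field_simps flip: \<rho>)
    moreover have "M11 = - M00" using assms by (simp add: add_eq_0_iff)
    moreover have "M00 + of_real q * (M00 * of_real \<rho>) + of_real (q * q) * (1 * - M00) =
      M00 * of_real (1 - q * q + q * \<rho>)"
      by (simp add: algebra_simps)
    ultimately show "of_real s * cnj (of_real s) * M00 + of_real s * cnj (of_real (s * q) * z) * M01 +
      (of_real (s * q) * z) * cnj (of_real s) * M10 + (of_real (s * q) * z) * cnj (of_real (s * q) * z) * M11 = 0"
      by (simp only: z q of_real_0 mult_zero_right)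
  qed
qed

text \<open>The Kraus operator \<open>|0\<rangle>\<langle>f|\<close>, which also resets the measured qubit.\<close>

definition reset_op :: "complex \<Rightarrow> complex \<Rightarrow> op1" where
  "reset_op f0 f1 a b = (if a then 0 else if b then cnj f1 else cnj f0)"

lemma kraus_complete_reset:
  assumes "e0 * cnj e0 + e1 * cnj e1 = 1"
  shows "kraus_complete [reset_op e0 e1, reset_op (- cnj e1) (cnj e0)]"
  using assms by (auto simp: kraus_complete_def reset_op_def UNIV_bool algebra_simps)

text \<open>The reset qubit \<open>a\<close> drops out of the block without an explicit factor for
  its state 0: \<open>r0\<close> and \<open>r1\<close> vanish on sets containing \<open>a\<close>,
  so the same form of state reappears with block \<open>B\<close>.\<close>

lemma apply1_reset:
  assumes "a \<notin> B" "\<And>S. S \<inter> insert a B \<noteq> {} \<Longrightarrow> r0 S = 0" "\<And>S. S \<inter> insert a B \<noteq> {} \<Longrightarrow> r1 S = 0"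
  shows "apply1 (reset_op f0 f1) a (\<lambda>S. \<alpha> (S \<inter> insert a B) * r0 (S - insert a B) + \<beta> (S \<inter> insert a B) * r1 (S - insert a B)) =
    (\<lambda>S. (cnj f0 * \<alpha> (S \<inter> B) + cnj f1 * \<alpha> (insert a (S \<inter> B))) * r0 (S - B) +
      (cnj f0 * \<beta> (S \<inter> B) + cnj f1 * \<beta> (insert a (S \<inter> B))) * r1 (S - B))"
    (is "_ = ?R")
proof
  fix S
  show "apply1 (reset_op f0 f1) a (\<lambda>S. \<alpha> (S \<inter> insert a B) * r0 (S - insert a B) + \<beta> (S \<inter> insert a B) * r1 (S - insert a B)) S = ?R S"
  proof (cases "a \<in> S")
    case True
    then have "(S - B) \<inter> insert a B \<noteq> {}" using assms(1) by auto
    then have "r0 (S - B) = 0" "r1 (S - B) = 0" using assms(2,3) by simp_all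
    then show ?thesis using True by (simp add: apply1_def reset_op_def)
  next
    case False
    then have "S - {a} = S" "S \<inter> insert a B = S \<inter> B" "S - insert a B = S - B"
      "insert a S \<inter> insert a B = insert a (S \<inter> B)" "insert a S - insert a B = S - B"
      using assms(1) by auto
    then show ?thesis using False by (simp only: apply1_def reset_op_def if_False if_True) (simp add: algebra_simps)
  qed
qed

text \<open>The argument of Walgate et al.: the first qubit has a basis that keeps the conditional states
  of the others orthogonal.\<close>

lemma steerable_distinguish:
  assumes "finite B" "B \<subseteq> E" "(\<Sum>X\<in>Pow B. cnj (\<alpha> X) * \<beta> X) = 0"
    "\<And>S. S \<inter> B \<noteq> {} \<Longrightarrow> r0 S = 0" "\<And>S. S \<inter> B \<noteq> {} \<Longrightarrow> r1 S = 0"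
    "\<And>c. steerable E Q (\<lambda>S. c * r0 S)" "\<And>c. steerable E Q (\<lambda>S. c * r1 S)"
  shows "steerable E Q (\<lambda>S. \<alpha> (S \<inter> B) * r0 (S - B) + \<beta> (S \<inter> B) * r1 (S - B))"
  using assms(1-5)
proof (induction B arbitrary: \<alpha> \<beta> rule: finite_induct)
  case empty
  \<comment> \<open>With no qubit left, orthogonality of two scalars means that one vanishes: a
    single residual state survives.\<close>
  then have "\<alpha> {} = 0 \<or> \<beta> {} = 0" by simp
  then show ?case using assms(6)[of "\<alpha> {}"] assms(7)[of "\<beta> {}"] by auto
next
  case (insert a B)
  define M00 M01 M10 M11 where "M00 = (\<Sum>X\<in>Pow B. cnj (\<alpha> X) * \<beta> X)"
    and "M01 = (\<Sum>X\<in>Pow B. cnj (\<alpha> X) * \<beta> (insert a X))"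
    and "M10 = (\<Sum>X\<in>Pow B. cnj (\<alpha> (insert a X)) * \<beta> X)"
    and "M11 = (\<Sum>X\<in>Pow B. cnj (\<alpha> (insert a X)) * \<beta> (insert a X))"
  \<comment> \<open>The orthogonality hypothesis, split by the value of qubit \<open>a\<close>, is
    the vanishing of the trace of the matrix of conditional inner products.\<close>
  have transfer: "M00 + M11 = 0"
    using insert.prems(2) insert.hyps
    by (simp add: Pow_insert_sum M00_def M11_def sum.distrib)
  then obtain e0 e1 where e: "e0 * cnj e0 + e1 * cnj e1 = 1"
    "e0 * cnj e0 * M00 + e0 * cnj e1 * M01 + e1 * cnj e0 * M10 + e1 * cnj e1 * M11 = 0"
    using traceless_isotropic by blast
  have step: "steerable E Q (apply1 (reset_op f0 f1) a (\<lambda>S. \<alpha> (S \<inter> insert a B) * r0 (S - insert a B) + \<beta> (S \<inter> insert a B) * r1 (S - insert a B)))"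
    if "f0 * cnj f0 * M00 + f0 * cnj f1 * M01 + f1 * cnj f0 * M10 + f1 * cnj f1 * M11 = 0" for f0 f1
  proof (subst apply1_reset)
    show "a \<notin> B" by (rule insert.hyps(2))
    show "r0 S = 0" if "S \<inter> insert a B \<noteq> {}" for S using that by (rule insert.prems(3))
    show "r1 S = 0" if "S \<inter> insert a B \<noteq> {}" for S using that by (rule insert.prems(4))
    show "steerable E Q (\<lambda>S. (cnj f0 * \<alpha> (S \<inter> B) + cnj f1 * \<alpha> (insert a (S \<inter> B))) * r0 (S - B) +
      (cnj f0 * \<beta> (S \<inter> B) + cnj f1 * \<beta> (insert a (S \<inter> B))) * r1 (S - B))"
    proof (rule insert.IH)
    have "(\<Sum>X\<in>Pow B. cnj (cnj f0 * \<alpha> X + cnj f1 * \<alpha> (insert a X)) * (cnj f0 * \<beta> X + cnj f1 * \<beta> (insert a X))) =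
      f0 * cnj f0 * M00 + f0 * cnj f1 * M01 + f1 * cnj f0 * M10 + f1 * cnj f1 * M11"
      unfolding M00_def M01_def M10_def M11_def sum_distrib_left sum.distrib[symmetric]
      by (intro sum.cong refl) (simp add: algebra_simps)
    then show "(\<Sum>X\<in>Pow B. cnj (cnj f0 * \<alpha> X + cnj f1 * \<alpha> (insert a X)) * (cnj f0 * \<beta> X + cnj f1 * \<beta> (insert a X))) = 0"
      using that by simp
    show "B \<subseteq> E" using insert.prems(1) by simp
    show "r0 S = 0" if "S \<inter> B \<noteq> {}" for S using that insert.prems(3)[of S] by blast
    show "r1 S = 0" if "S \<inter> B \<noteq> {}" for S using that insert.prems(4)[of S] by blast
    qed
  qed
  have M11: "M11 = - M00" using transfer by (simp add: add_eq_0_iff)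
  \<comment> \<open>The second basis vector is isotropic as well, since the form takes opposite
    values on an orthonormal pair when the trace is 0.\<close>
  have "- cnj e1 * cnj (- cnj e1) * M00 + - cnj e1 * cnj (cnj e0) * M01 +
      cnj e0 * cnj (- cnj e1) * M10 + cnj e0 * cnj (cnj e0) * M11 = 
    - (e0 * cnj e0 * M00 + e0 * cnj e1 * M01 + e1 * cnj e0 * M10 + e1 * cnj e1 * M11)"
    unfolding M11 by (simp add: algebra_simps)
  then have e': "- cnj e1 * cnj (- cnj e1) * M00 + - cnj e1 * cnj (cnj e0) * M01 +
      cnj e0 * cnj (- cnj e1) * M10 + cnj e0 * cnj (cnj e0) * M11 = 0"
    unfolding e(2) by simp
  show ?case
    by (rule steerable_meas[OF _ kraus_complete_reset[OF e(1)]])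
      (use insert.prems(1) step[OF e(2)] step[OF e'] in auto)
qed

section \<open>Encoded registers\<close>

text \<open>The variant of \<open>encode\<close> with arbitrary labels, for a register that shrinks:
  blocks whose label has left \<open>V\<close> are forced to state 0, as the reset leaves
  them.\<close>

definition enc :: "nat \<Rightarrow> nat qvec \<Rightarrow> nat qvec \<Rightarrow> ('l \<Rightarrow> 'q list) \<Rightarrow> 'l set \<Rightarrow> 'l qvec \<Rightarrow> 'q qvec" where
  "enc m zL oL blk V v = (\<lambda>S. if S \<subseteq> (\<Union>k\<in>V. set (blk k)) then
     \<Sum>x\<in>Pow V. v x * (\<Prod>k\<in>V. (if k \<in> x then oL else zL) {j. j < m \<and> blk k ! j \<in> S}) else 0)"

lemma enc_linear:
  "enc m zL oL blk V (\<lambda>x. u x + d * v x) = (\<lambda>S. enc m zL oL blk V u S + d * enc m zL oL blk V v S)"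
  by (simp add: enc_def fun_eq_iff sum.distrib sum_distrib_left algebra_simps)

lemma sum_Pow_block:
  assumes "distinct b"
  shows "(\<Sum>X\<in>Pow (set b). g {j. j < length b \<and> b ! j \<in> X}) = (\<Sum>J\<in>Pow {..<length b}. g J)"
proof (rule sum.reindex_bij_witness[of _ "\<lambda>J. (!) b ` J" "\<lambda>X. {j. j < length b \<and> b ! j \<in> X}"])
  fix J assume "J \<in> Pow {..<length b}"
  then show "{j. j < length b \<and> b ! j \<in> (!) b ` J} = J" "(!) b ` J \<in> Pow (set b)"
    using assms by (auto simp: nth_eq_iff_index_eq)
next
  fix X assume "X \<in> Pow (set b)"
  then show "(!) b ` {j. j < length b \<and> b ! j \<in> X} = X"
    by (auto simp: image_iff in_set_conv_nth subset_iff)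
qed auto

context
  fixes E :: "'q set" and m :: nat and zL oL :: "nat qvec" and blk :: "'l \<Rightarrow> 'q list" and U :: "'l set"
  assumes zL: "is_state {..<m} zL" and oL: "is_state {..<m} oL" and ortho: "qinner {..<m} zL oL = 0"
    and blk: "\<And>k. k \<in> U \<Longrightarrow> length (blk k) = m \<and> distinct (blk k) \<and> set (blk k) \<subseteq> E"
    and disj: "\<And>k l. k \<in> U \<Longrightarrow> l \<in> U \<Longrightarrow> k \<noteq> l \<Longrightarrow> set (blk k) \<inter> set (blk l) = {}"
    and finU: "finite U"
begin

abbreviation "encL \<equiv> enc m zL oL blk"
abbreviation "place v k X \<equiv> v {j. j < m \<and> blk k ! j \<in> X}"

lemma enc_split:
  assumes "V \<subseteq> U" "k \<in> V"
  shows "encL V v = (\<lambda>S. place zL k (S \<inter> set (blk k)) * encL (V - {k}) v (S - set (blk k)) +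
    place oL k (S \<inter> set (blk k)) * encL (V - {k}) (\<lambda>x. v (insert k x)) (S - set (blk k)))"
proof
  fix S
  define C where "C = V - {k}"
  have V: "V = insert k C" "k \<notin> C" using assms by (auto simp: C_def)
  have finC: "finite C" using finite_subset[OF assms(1) finU] by (simp add: C_def)
  define B where "B = set (blk k)"
  define f where "f l z X = (if z then oL else zL) {j. j < m \<and> blk l ! j \<in> X}" for l z X
  have fk: "f k z (S \<inter> B) = f k z S" for z
  proof -
    have "length (blk k) = m" using blk assms by blast
    then have "{j. j < m \<and> blk k ! j \<in> S \<inter> B} = {j. j < m \<and> blk k ! j \<in> S}"
      by (auto simp: B_def)
    then show ?thesis by (simp add: f_def)
  qed
  have fl: "f l z (S - B) = f l z S" if "l \<in> C" for l z
  proof -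
    have "length (blk l) = m" "set (blk l) \<inter> B = {}"
      using blk[of l] disj[of l k] that assms by (auto simp: C_def B_def)
    then have "{j. j < m \<and> blk l ! j \<in> S - B} = {j. j < m \<and> blk l ! j \<in> S}"
      using nth_mem by fastforce
    then show ?thesis by (simp add: f_def)
  qed
  have sub: "S \<subseteq> (\<Union>l\<in>V. set (blk l)) \<longleftrightarrow> S - B \<subseteq> (\<Union>l\<in>C. set (blk l))"
    unfolding V(1) B_def by auto
  show "encL V v S = place zL k (S \<inter> set (blk k)) * encL (V - {k}) v (S - set (blk k)) +
    place oL k (S \<inter> set (blk k)) * encL (V - {k}) (\<lambda>x. v (insert k x)) (S - set (blk k))"
  proof (cases "S - B \<subseteq> (\<Union>l\<in>C. set (blk l))")
    case True
    have "(\<Sum>x\<in>Pow V. v x * (\<Prod>l\<in>V. f l (l \<in> x) S)) =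
      (\<Sum>x\<in>Pow C. v x * (\<Prod>l\<in>V. f l (l \<in> x) S) + v (insert k x) * (\<Prod>l\<in>V. f l (l \<in> insert k x) S))"
      unfolding V(1) using V finC by (simp add: Pow_insert_sum)
    also have "\<dots> = (\<Sum>x\<in>Pow C. f k False S * (v x * (\<Prod>l\<in>C. f l (l \<in> x) (S - B))) + 
        f k True S * (v (insert k x) * (\<Prod>l\<in>C. f l (l \<in> x) (S - B))))"
    proof (rule sum.cong[OF refl])
      fix x assume "x \<in> Pow C"
      then have "k \<notin> x" using V by auto
      moreover have "l \<noteq> k" if "l \<in> C" for l using that V by auto
      ultimately have "k \<notin> x" "(\<Prod>l\<in>C. f l (l \<in> insert k x) S) = (\<Prod>l\<in>C. f l (l \<in> x) (S - B))"
        "(\<Prod>l\<in>C. f l (l \<in> x) S) = (\<Prod>l\<in>C. f l (l \<in> x) (S - B))"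
        by (auto intro!: prod.cong simp: fl)
      then show "v x * (\<Prod>l\<in>V. f l (l \<in> x) S) + v (insert k x) * (\<Prod>l\<in>V. f l (l \<in> insert k x) S) =
        f k False S * (v x * (\<Prod>l\<in>C. f l (l \<in> x) (S - B))) + f k True S * (v (insert k x) * (\<Prod>l\<in>C. f l (l \<in> x) (S - B)))"
        unfolding V(1) prod.insert[OF finC V(2)] by simp
    qed
    finally have "(\<Sum>x\<in>Pow V. v x * (\<Prod>l\<in>V. f l (l \<in> x) S)) =
      f k False (S \<inter> B) * (\<Sum>x\<in>Pow C. v x * (\<Prod>l\<in>C. f l (l \<in> x) (S - B))) +
      f k True (S \<inter> B) * (\<Sum>x\<in>Pow C. v (insert k x) * (\<Prod>l\<in>C. f l (l \<in> x) (S - B)))"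
      by (simp add: sum.distrib sum_distrib_left fk)
    then show ?thesis
      using True sub unfolding enc_def f_def B_def C_def by simp
  next
    case False
    then show ?thesis using sub unfolding enc_def B_def C_def by simp
  qed
qed

lemma enc_off:
  assumes "V \<subseteq> U" "k \<in> V" "S \<inter> set (blk k) \<noteq> {}"
  shows "encL (V - {k}) v S = 0"
proof -
  have "(\<Union>l\<in>V - {k}. set (blk l)) \<inter> set (blk k) = {}"
    using disj assms(1,2) by fastforce
  then have "\<not> S \<subseteq> (\<Union>l\<in>V - {k}. set (blk l))" using assms(3) by blast
  then show ?thesis by (simp add: enc_def)
qed

lemma block_inner:
  assumes "k \<in> U"
  shows "(\<Sum>X\<in>Pow (set (blk k)). cnj (place zL k X) * place zL k X) = 1"
    "(\<Sum>X\<in>Pow (set (blk k)). cnj (place oL k X) * place oL k X) = 1"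
    "(\<Sum>X\<in>Pow (set (blk k)). cnj (place zL k X) * place oL k X) = 0"
    "(\<Sum>X\<in>Pow (set (blk k)). cnj (place oL k X) * place zL k X) = 0"
proof -
  have m: "m = length (blk k)" "distinct (blk k)" using blk[OF assms] by auto
  have *: "(\<Sum>X\<in>Pow (set (blk k)). cnj (place u k X) * place w k X) = qinner {..<m} u w" for u w :: "nat qvec"
    unfolding qinner_def m(1) by (rule sum_Pow_block[OF m(2)])
  have norm: "qinner {..<m} u u = 1" if "is_state {..<m} u" for u
  proof -
    have "qinner {..<m} u u = of_real (\<Sum>S\<in>Pow {..<m}. (cmod (u S))\<^sup>2)"
      unfolding qinner_def of_real_sum by (intro sum.cong refl) (metis complex_norm_square mult.commute)
    then show ?thesis using that unfolding is_state_def by (metis of_real_1)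
  qed
  have "qinner {..<m} oL zL = cnj (qinner {..<m} zL oL)"
    by (simp add: qinner_def mult.commute)
  then show "(\<Sum>X\<in>Pow (set (blk k)). cnj (place oL k X) * place zL k X) = 0"
    unfolding * by (simp add: ortho)
  show "(\<Sum>X\<in>Pow (set (blk k)). cnj (place zL k X) * place zL k X) = 1"
    "(\<Sum>X\<in>Pow (set (blk k)). cnj (place oL k X) * place oL k X) = 1"
    "(\<Sum>X\<in>Pow (set (blk k)). cnj (place zL k X) * place oL k X) = 0"
    unfolding * using norm zL oL ortho by simp_all
qed

text \<open>Each logical measurement becomes the discrimination of two orthogonal block states
  correlated with the two residual states. All scalars \<open>c\<close> are treated together because
  discrimination multiplies residuals by unknown factors.\<close>

lemma logically_steerable_imp:
  assumes "logically_steerable (\<lambda>V v. \<forall>c. steerable E R (\<lambda>S. c * encL V v S)) V v" "V \<subseteq> U"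
  shows "steerable E R (\<lambda>S. c * encL V v S)"
  using assms
proof (induction arbitrary: c rule: logically_steerable.induct)
  case (logically_steerable_stop V v)
  then show ?case by blast
next
  case (logically_steerable_Z k V v)
  have k: "k \<in> U" and sub: "V - {k} \<subseteq> U" using logically_steerable_Z by auto
  have "(\<Sum>X\<in>Pow (set (blk k)). cnj (c * place zL k X) * (c * place oL k X)) =
    cnj c * c * (\<Sum>X\<in>Pow (set (blk k)). cnj (place zL k X) * place oL k X)"
    by (simp add: sum_distrib_left mult_ac)
  then have 0: "(\<Sum>X\<in>Pow (set (blk k)). cnj (c * place zL k X) * (c * place oL k X)) = 0"
    unfolding block_inner(3)[OF k] by simp
  have "steerable E R (\<lambda>S. (c * place zL k (S \<inter> set (blk k))) * encL (V - {k}) v (S - set (blk k)) +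
    (c * place oL k (S \<inter> set (blk k))) * encL (V - {k}) (\<lambda>x. v (insert k x)) (S - set (blk k)))"
    by (rule steerable_distinguish[OF _ _ 0])
      (use blk[OF k] logically_steerable_Z.IH[OF sub] enc_off[OF logically_steerable_Z.prems logically_steerable_Z.hyps(1)] in auto)
  then show ?case
    unfolding enc_split[OF logically_steerable_Z.prems logically_steerable_Z.hyps(1)] by (simp add: algebra_simps)
next
  case (logically_steerable_XY k V \<omega> v)
  have k: "k \<in> U" and sub: "V - {k} \<subseteq> U" using logically_steerable_XY by auto
  have \<omega>: "cnj \<omega> * \<omega> = 1" using logically_steerable_XY.hyps(2) by (metis complex_norm_square mult.commute of_real_1 one_power2)
  define B where "B = set (blk k)"
  \<comment> \<open>With p and q the residuals, zL p + oL q is half of (zL + cnj \<omega> oL)(p +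
    \<omega> q) + (zL - cnj \<omega> oL)(p - \<omega> q); the two block states are orthogonal since
    |\<omega>| = 1.\<close>
  define \<alpha> \<beta> where "\<alpha> X = c / 2 * (place zL k X + cnj \<omega> * place oL k X)"
    and "\<beta> X = c / 2 * (place zL k X - cnj \<omega> * place oL k X)" for X
  have "(\<Sum>X\<in>Pow B. cnj (\<alpha> X) * \<beta> X) = (\<Sum>X\<in>Pow B. cnj (c / 2) * (c / 2) *
      (cnj (place zL k X) * place zL k X - cnj \<omega> * (cnj (place zL k X) * place oL k X) +
       \<omega> * (cnj (place oL k X) * place zL k X) - cnj \<omega> * \<omega> * (cnj (place oL k X) * place oL k X)))"
    by (intro sum.cong refl) (simp add: \<alpha>_def \<beta>_def algebra_simps)
  also have "\<dots> = cnj (c / 2) * (c / 2) * (1 - cnj \<omega> * 0 + \<omega> * 0 - cnj \<omega> * \<omega> * 1)"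
    by (simp only: sum_distrib_left[symmetric] sum_subtractf sum.distrib B_def block_inner[OF k])
  finally have 0: "(\<Sum>X\<in>Pow B. cnj (\<alpha> X) * \<beta> X) = 0" by (simp add: \<omega>)
  define r0 r1 where "r0 = encL (V - {k}) v" and "r1 = encL (V - {k}) (\<lambda>x. v (insert k x))"
  have lin: "encL (V - {k}) (\<lambda>x. v x + \<omega> * v (insert k x)) = (\<lambda>S. r0 S + \<omega> * r1 S)"
    "encL (V - {k}) (\<lambda>x. v x - \<omega> * v (insert k x)) = (\<lambda>S. r0 S - \<omega> * r1 S)"
    using enc_linear[of m zL oL blk "V - {k}" v "- \<omega>"] by (simp_all add: enc_linear r0_def r1_def)
  have off: "r0 S = 0" "r1 S = 0" if "S \<inter> B \<noteq> {}" for S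
    using enc_off[OF logically_steerable_XY.prems logically_steerable_XY.hyps(1)] that by (simp_all add: B_def r0_def r1_def)
  have "steerable E R (\<lambda>S. \<alpha> (S \<inter> B) * (\<lambda>S. r0 S + \<omega> * r1 S) (S - B) + \<beta> (S \<inter> B) * (\<lambda>S. r0 S - \<omega> * r1 S) (S - B))"
    by (rule steerable_distinguish[OF _ _ 0])
      (use blk[OF k] logically_steerable_XY.IH[OF sub] off in \<open>auto simp: lin B_def\<close>)
  moreover have "\<alpha> X * (p + \<omega> * q) + \<beta> X * (p - \<omega> * q) = c * (place zL k X * p + place oL k X * q)" for X p q
  proof -
    have "\<alpha> X * (p + \<omega> * q) + \<beta> X * (p - \<omega> * q) = c * (place zL k X * p + (cnj \<omega> * \<omega>) * (place oL k X * q))"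
      by (simp add: \<alpha>_def \<beta>_def field_simps)
    then show ?thesis by (simp add: \<omega>)
  qed
  ultimately show ?case
    unfolding enc_split[OF logically_steerable_XY.prems logically_steerable_XY.hyps(1)] B_def r0_def r1_def by simp
qed

end

lemma encode_enc:
  assumes f: "bij_betw f {..<length bs} V" and blk: "\<And>k. k < length bs \<Longrightarrow> blk (f k) = bs ! k"
    and E: "\<Union>(set ` set bs) \<subseteq> E" and v: "\<And>x. x \<subseteq> {..<length bs} \<Longrightarrow> phi x = v (f ` x)"
  shows "encode m zL oL E bs phi = enc m zL oL blk V v"
proof
  fix S
  have inj: "inj_on f {..<length bs}" and V: "V = f ` {..<length bs}" using f by (auto simp: bij_betw_def)
  have "(\<Union>k\<in>V. set (blk k)) = \<Union>(set ` set bs)"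
    unfolding V by (auto simp: blk in_set_conv_nth) (metis blk lessThan_iff nth_mem)+
  then have sub: "S \<subseteq> E \<and> S \<inter> (E - \<Union>(set ` set bs)) = {} \<longleftrightarrow> S \<subseteq> (\<Union>k\<in>V. set (blk k))"
    using E by auto
  have "(\<Sum>x\<in>Pow V. v x * (\<Prod>k\<in>V. (if k \<in> x then oL else zL) {j. j < m \<and> blk k ! j \<in> S})) =
    (\<Sum>x\<in>Pow {..<length bs}. v (f ` x) * (\<Prod>k\<in>V. (if k \<in> f ` x then oL else zL) {j. j < m \<and> blk k ! j \<in> S}))"
    unfolding V using inj_on_image_Pow[OF inj]
    by (subst image_Pow_surj[OF refl, symmetric]) (simp add: sum.reindex)
  also have "\<dots> = (\<Sum>x\<in>Pow {..<length bs}. phi x * (\<Prod>k<length bs. (if k \<in> x then oL else zL) {j. j < m \<and> bs ! k ! j \<in> S}))"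
  proof (rule sum.cong[OF refl])
    fix x assume x: "x \<in> Pow {..<length bs}"
    then have "f k \<in> f ` x \<longleftrightarrow> k \<in> x" if "k < length bs" for k
      using that inj by (auto dest: inj_onD)
    then show "v (f ` x) * (\<Prod>k\<in>V. (if k \<in> f ` x then oL else zL) {j. j < m \<and> blk k ! j \<in> S}) =
      phi x * (\<Prod>k<length bs. (if k \<in> x then oL else zL) {j. j < m \<and> bs ! k ! j \<in> S})"
      unfolding V using inj x by (simp add: prod.reindex blk v)
  qed
  finally show "encode m zL oL E bs phi S = enc m zL oL blk V v S"
    using sub by (simp add: encode_def enc_def)
qed

section \<open>Products of Pauli operators as labels\<close>

definition pauli :: "bool \<Rightarrow> bool \<Rightarrow> op1" where
  "pauli a b = (if a then if b then pauli_Y else pauli_X else if b then pauli_Z else pauli_I)"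

lemma pauli_in_paulis: "pauli a b \<in> paulis"
  by (simp add: pauli_def paulis_def)

lemma paulis_pauli: "P \<in> paulis \<Longrightarrow> \<exists>a b. P = pauli a b"
  unfolding paulis_def pauli_def by (metis (full_types) empty_iff insert_iff)

lemma apply1_pauli:
  "apply1 (pauli a b) k v =
    (\<lambda>S. (if a \<and> b then - \<i> else 1) * W (if a then {k} else {}) (if b then {k} else {}) v S)"
  by (auto simp: fun_eq_iff apply1_def W_def pauli_def pauli_X_def pauli_Y_def pauli_Z_def pauli_I_def
      zs_singleton sd_def insert_absorb)

lemma apply1_scale: "apply1 U a (\<lambda>S. c * v S) = (\<lambda>S. c * apply1 U a v S)"
  by (simp add: apply1_def fun_eq_iff algebra_simps)

lemma apply_ops_cong: "(\<And>k. k < n \<Longrightarrow> ps k = qs k) \<Longrightarrow> apply_ops ps n v = apply_ops qs n v"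
  by (induction n) auto

lemma apply_ops_pauli:
  "\<exists>c. c \<noteq> 0 \<and> (\<forall>v. apply_ops (\<lambda>k. pauli (k \<in> A) (k \<in> B)) n v = (\<lambda>S. c * W (A \<inter> {..<n}) (B \<inter> {..<n}) v S))"
proof (induction n)
  case 0
  show ?case by (intro exI[of _ 1]) simp
next
  case (Suc n)
  then obtain c where c: "c \<noteq> 0"
    "\<And>v. apply_ops (\<lambda>k. pauli (k \<in> A) (k \<in> B)) n v = (\<lambda>S. c * W (A \<inter> {..<n}) (B \<inter> {..<n}) v S)"
    by blast
  define a b where "a = (if n \<in> A then {n} else {})" and "b = (if n \<in> B then {n} else {})"
  have *: "a \<ominus> (A \<inter> {..<n}) = A \<inter> {..<Suc n}" "b \<ominus> (B \<inter> {..<n}) = B \<inter> {..<Suc n}"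
    by (auto simp: a_def b_def sd_def less_Suc_eq)
  define d where "d = (if n \<in> A \<and> n \<in> B then - \<i> else 1)"
  have fin: "finite b" "finite (B \<inter> {..<n})" by (simp_all add: b_def)
  have "apply_ops (\<lambda>k. pauli (k \<in> A) (k \<in> B)) (Suc n) v =
    (\<lambda>S. (c * d * zs (B \<inter> {..<n}) a) * W (A \<inter> {..<Suc n}) (B \<inter> {..<Suc n}) v S)" for v
  proof -
    have "apply_ops (\<lambda>k. pauli (k \<in> A) (k \<in> B)) (Suc n) v =
      (\<lambda>S. c * (d * W a b (W (A \<inter> {..<n}) (B \<inter> {..<n}) v) S))"
      by (simp only: apply_ops.simps c(2) apply1_scale apply1_pauli a_def b_def d_def)
    then show ?thesis unfolding W_W[OF fin] * by (simp add: mult.assoc)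
  qed
  moreover have "c * d * zs (B \<inter> {..<n}) a \<noteq> 0" using c(1) by (simp add: d_def)
  ultimately show ?case by blast
qed

lemma apply_ops_paulis:
  assumes "\<forall>k<n. ps k \<in> paulis"
  obtains c A B where "A \<subseteq> {..<n}" "B \<subseteq> {..<n}" "\<And>v. apply_ops ps n v = (\<lambda>S. c * W A B v S)"
proof -
  have "\<forall>k. \<exists>p. k < n \<longrightarrow> ps k = pauli (fst p) (snd p)"
    using assms paulis_pauli by (metis fst_conv snd_conv)
  from choice[OF this] obtain p where p: "\<And>k. k < n \<Longrightarrow> ps k = pauli (fst (p k)) (snd (p k))"
    by blast
  define A B where "A = {k. fst (p k)}" and "B = {k. snd (p k)}"
  obtain c where c: "\<And>v. apply_ops (\<lambda>k. pauli (k \<in> A) (k \<in> B)) n v =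
    (\<lambda>S. c * W (A \<inter> {..<n}) (B \<inter> {..<n}) v S)"
    using apply_ops_pauli[of A B n] by blast
  have "apply_ops ps n v = apply_ops (\<lambda>k. pauli (k \<in> A) (k \<in> B)) n v" for v
    by (rule apply_ops_cong) (simp add: p A_def B_def)
  then have "apply_ops ps n v = (\<lambda>S. c * W (A \<inter> {..<n}) (B \<inter> {..<n}) v S)" for v
    by (simp only: c)
  then show ?thesis by (intro that[of "A \<inter> {..<n}" "B \<inter> {..<n}" c]) simp_all
qed

section \<open>Cluster states and the theorem\<close>

definition grid_index :: "nat \<Rightarrow> nat \<Rightarrow> nat \<times> nat" where
  "grid_index d k = (k div d, k mod d)"

lemma inj_grid_index: "inj (grid_index d)"
proof (rule injI)
  fix k l assume "grid_index d k = grid_index d l"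
  then show "k = l" by (metis Pair_inject div_mult_mod_eq grid_index_def)
qed

lemma grid_index_pair: "c < d \<Longrightarrow> grid_index d (r * d + c) = (r, c)"
  by (simp add: grid_index_def)

lemma grid_index_image: "grid_index d ` {..<d * d} = {..<d} \<times> {..<d}"
proof
  show "grid_index d ` {..<d * d} \<subseteq> {..<d} \<times> {..<d}"
    by (cases "d = 0") (auto simp: grid_index_def less_mult_imp_div_less)
  show "{..<d} \<times> {..<d} \<subseteq> grid_index d ` {..<d * d}"
  proof clarify
    fix r c assume "r < d" "c < d"
    then have "r * d + c < d * d"
      by (metis add.commute add_less_cancel_left less_le_trans mult_Suc mult_le_mono1 Suc_leI)
    then show "(r, c) \<in> grid_index d ` {..<d * d}" using grid_index_pair[OF \<open>c < d\<close>, of r] by (metis imageI lessThan_iff)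
  qed
qed

lemma grid_nb_index:
  assumes "a < d * d" "b < d * d"
  shows "grid_index d b \<in> grid_nb {grid_index d a} \<longleftrightarrow> grid_adj d a b"
proof -
  have "(r', c') \<in> grid_nb {(r, c)} \<longleftrightarrow>
    r = r' \<and> (c + 1 = c' \<or> c' + 1 = c) \<or> c = c' \<and> (r + 1 = r' \<or> r' + 1 = r)" for r c r' c'
    unfolding grid_nb_def sd_def up_def right_def by auto
  then show ?thesis
    unfolding grid_adj_def grid_index_def using assms by blast
qed

lemma zs_grid_adj:
  assumes "a < d * d" "T \<subseteq> {..<d * d}"
  shows "zs {b. grid_adj d a b} T = zs (grid_nb {grid_index d a}) (grid_index d ` T)"
proof -
  have "grid_index d ` ({b. grid_adj d a b} \<inter> T) = grid_nb {grid_index d a} \<inter> grid_index d ` T"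
    using assms grid_nb_index[OF assms(1)] by auto
  then have "card ({b. grid_adj d a b} \<inter> T) = card (grid_nb {grid_index d a} \<inter> grid_index d ` T)"
    using card_image[OF inj_on_subset[OF inj_grid_index subset_UNIV]] by metis
  then show ?thesis by (simp add: zs_def)
qed

lemma stabiliser_apply:
  "apply1 pauli_X a (apply_Zs N v) S = zs N (S \<ominus> {a}) * v (S \<ominus> {a})"
  by (auto simp: apply1_def pauli_X_def apply_Zs_def zs_def sd_def)

lemma grid_sign_index_sd:
  assumes "finite T" "finite A"
  shows "grid_sign (grid_index d ` (T \<ominus> A)) = grid_sign (grid_index d ` T) * grid_sign (grid_index d ` A) * zs (grid_nb (grid_index d ` A)) (grid_index d ` T)"
  using assms by (simp add: image_sd inj_grid_index grid_sign_sd)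

lemma cmod_grid_sign: "cmod (grid_sign S) = 1"
proof -
  have "cmod (zs A B) = 1" for A B :: "(nat \<times> nat) set" using zs_cases[of A B] by auto
  then show ?thesis by (simp add: grid_sign_def edge_sign_def norm_mult)
qed

lemma cluster_state_exists: "\<exists>phi. is_cluster_state d phi"
proof -
  define s :: complex where "s = of_real (1 / sqrt (2 ^ (d * d)))"
  define phi :: "nat qvec" where
    "phi T = (if T \<subseteq> {..<d * d} then s * grid_sign (grid_index d ` T) else 0)" for T
  have "(cmod (phi T))\<^sup>2 = 1 / 2 ^ (d * d)" if "T \<subseteq> {..<d * d}" for T
    using that by (simp add: phi_def s_def norm_mult norm_divide cmod_grid_sign power_divide)
  then have "(\<Sum>T\<in>Pow {..<d * d}. (cmod (phi T))\<^sup>2) = 1"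
    by (simp add: card_Pow)
  then have "is_state {..<d * d} phi"
    by (simp add: is_state_def supported_def phi_def)
  moreover have "apply1 pauli_X a (apply_Zs {b. grid_adj d a b} phi) = phi" if a: "a < d * d" for a
  proof
    fix S
    show "apply1 pauli_X a (apply_Zs {b. grid_adj d a b} phi) S = phi S"
    proof (cases "S \<subseteq> {..<d * d}")
      case True
      then have T: "S \<ominus> {a} \<subseteq> {..<d * d}" using a by simp
      then have "finite (S \<ominus> {a})" using finite_subset by blast
      then have "grid_sign (grid_index d ` S) = grid_sign (grid_index d ` (S \<ominus> {a})) * zs (grid_nb {grid_index d a}) (grid_index d ` (S \<ominus> {a}))"
        using grid_sign_index_sd[of "S \<ominus> {a}" "{a}" d] by simp
      then show ?thesis
        using True T by (simp add: stabiliser_apply phi_def zs_grid_adj[OF a T] mult_ac)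
    next
      case False
      then have "\<not> S \<ominus> {a} \<subseteq> {..<d * d}" using a by simp
      with False show ?thesis by (simp add: stabiliser_apply phi_def)
    qed
  qed
  ultimately show ?thesis unfolding is_cluster_state_def by blast
qed

text \<open>The stabiliser equation at \<open>a\<close> determines the amplitude after toggling
  \<open>a\<close>, so all amplitudes follow from the empty configuration.\<close>

lemma cluster_state_form:
  assumes "is_cluster_state d phi" "T \<subseteq> {..<d * d}"
  shows "phi T = phi {} * grid_sign (grid_index d ` T)"
proof -
  have "finite T" using assms(2) finite_subset by blast
  then show ?thesis using assms(2)
  proof (induction T rule: finite_induct)
    case empty then show ?case by simp
  next
    case (insert a T)
    then have a: "a < d * d" and T: "T \<subseteq> {..<d * d}" by auto
    have ins: "insert a T \<ominus> {a} = T" "T \<ominus> {a} = insert a T" using insert.hyps by (auto simp: sd_def)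
    have "phi (insert a T) = apply1 pauli_X a (apply_Zs {b. grid_adj d a b} phi) (insert a T)"
      using assms(1) a by (simp add: is_cluster_state_def)
    also have "\<dots> = zs (grid_nb {grid_index d a}) (grid_index d ` T) * phi T"
      by (simp add: stabiliser_apply ins zs_grid_adj[OF a T])
    also have "phi T = phi {} * grid_sign (grid_index d ` T)" using insert.IH T by simp
    finally show ?case
      using grid_sign_index_sd[OF insert.hyps(1), of "{a}" d] by (simp add: ins(2) mult_ac)
  qed
qed

text \<open>On a graph state an X byproduct acts, up to a scalar, as Z on the neighbours, so
  arbitrary Pauli byproducts fit the Z-only form of \<open>grid_state\<close>.\<close>

lemma grid_state_cluster:
  assumes phi: "is_cluster_state d phi" and AB: "A \<subseteq> {..<d * d}" "B \<subseteq> {..<d * d}"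
    and v: "\<And>T. T \<subseteq> {..<d * d} \<Longrightarrow> v (grid_index d ` T) = c * W A B phi T"
  shows "grid_state ({..<d} \<times> {..<d}) v"
  unfolding grid_state_def
proof (intro exI conjI allI impI)
  have fin: "finite A" "finite B" using AB finite_subset by blast+
  show "finite (grid_index d ` B \<ominus> grid_nb (grid_index d ` A))" using fin by simp
  fix S assume "S \<subseteq> {..<d} \<times> {..<d}"
  then obtain T where T: "T \<subseteq> {..<d * d}" "S = grid_index d ` T"
    unfolding grid_index_image[symmetric] by (meson subset_imageE)
  then have "finite T" using finite_subset by blast
  have "v S = c * zs B T * phi (T \<ominus> A)" using v[OF T(1)] by (simp add: T W_def)
  also have "phi (T \<ominus> A) = phi {} * (grid_sign (grid_index d ` T) * grid_sign (grid_index d ` A) * zs (grid_nb (grid_index d ` A)) (grid_index d ` T))"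
    using cluster_state_form[OF phi, of "T \<ominus> A"] T AB \<open>finite T\<close> fin by (simp add: grid_sign_index_sd)
  also have "zs B T = zs (grid_index d ` B) S"
    unfolding T(2) by (simp add: zs_image inj_grid_index inj_vimage_image_eq)
  finally show "v S = (c * phi {} * grid_sign (grid_index d ` A)) * zs (grid_index d ` B \<ominus> grid_nb (grid_index d ` A)) S * grid_sign S"
    using fin \<open>finite T\<close> by (simp add: T(2) zs_sd_left mult_ac)
qed

lemma encode_scale: "encode m zL oL E bs (\<lambda>x. c * v x) = (\<lambda>S. c * encode m zL oL E bs v S)"
  by (simp add: encode_def fun_eq_iff sum_distrib_left mult_ac)

lemma generated_iff_steerable:
  "generated_LOCC_pauli E m zL oL P psi i n phi \<longleftrightarrow>
   (\<exists>bs. length bs = n \<and> distinct bs \<and> set bs \<subseteq> P i \<and>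
     steerable (E i) (\<lambda>w. \<exists>ps c. (\<forall>k<n. ps k \<in> paulis) \<and>
       w = (\<lambda>S. c * encode m zL oL (E i) bs (apply_ops ps n phi) S)) (psi i))"
  unfolding generated_LOCC_pauli_def
  by (intro ex_cong1 conj_cong refl iffI; (elim exE conjE)?; (rule protocol_steerable steerable_protocol)?) blast+

lemma universal_imp_cluster:
  "encoded_universal E m zL oL P psi \<Longrightarrow> cluster_generable E m zL oL P psi"
  unfolding encoded_universal_def cluster_generable_def
  using cluster_state_exists is_cluster_state_def by metis

lemma cluster_imp_generated:
  assumes fam: "consistent_family E m zL oL P" and gen: "cluster_generable E m zL oL P psi"
    and phi: "is_state {..<n} phi"
  shows "\<exists>i. generated_LOCC_pauli E m zL oL P psi i n phi"
proof -
  have st: "is_state {..<m} zL" "is_state {..<m} oL" "qinner {..<m} zL oL = 0"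
    and part: "\<And>i. partition_blocks m (E i) (P i)"
    using fam by (auto simp: consistent_family_def)
  have phi0: "supported {..<n} phi" "phi \<noteq> (\<lambda>_. 0)" using phi by (auto simp: is_state_def)
  obtain L where L: "\<And>d v Q. n \<le> d \<Longrightarrow> L < d \<Longrightarrow> grid_state ({..<d} \<times> {..<d}) v \<Longrightarrow>
    (\<And>v c A B. A \<subseteq> {..<n} \<Longrightarrow> B \<subseteq> {..<n} \<Longrightarrow>
      (\<And>x. x \<subseteq> {..<n} \<Longrightarrow> v (x \<times> {L}) = c * W A B phi x) \<Longrightarrow> Q ({..<n} \<times> {L}) v) \<Longrightarrow>
    logically_steerable Q ({..<d} \<times> {..<d}) v"
    by (rule logically_steerable_grid[OF phi0]; erule that)
  \<comment> \<open>Large enough for \<open>n\<close> rows and for a column of index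
    \<open>L\<close>.\<close>
  define d where "d = max n (Suc L)"
  have d: "n \<le> d" "L < d" by (auto simp: d_def)
  obtain cl i bs where cl: "is_cluster_state d cl" and bs: "length bs = d * d" "distinct bs" "set bs \<subseteq> P i"
    and steerable: "steerable (E i) (\<lambda>w. \<exists>ps c. (\<forall>k<d * d. ps k \<in> paulis) \<and>
       w = (\<lambda>S. c * encode m zL oL (E i) bs (apply_ops ps (d * d) cl) S)) (psi i)"
    using gen unfolding cluster_generable_def generated_iff_steerable by blast
  define blk where "blk q = bs ! (fst q * d + snd q)" for q
  define U where "U = {..<d} \<times> {..<d}"
  have U: "U = grid_index d ` {..<d * d}" by (simp add: U_def grid_index_image)
  have blk_index: "blk (grid_index d k) = bs ! k" for k
    by (simp add: blk_def grid_index_def)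
  have block: "blk q \<in> P i" if q: "q \<in> U" for q
  proof -
    obtain k where "k < d * d" "q = grid_index d k" using q unfolding U by blast
    then show ?thesis using bs nth_mem by (fastforce simp: blk_index)
  qed
  have blk_inj: "blk q \<noteq> blk q'" if q: "q \<in> U" "q' \<in> U" "q \<noteq> q'" for q q'
  proof -
    obtain k k' where "k < d * d" "q = grid_index d k" "k' < d * d" "q' = grid_index d k'"
      using q(1,2) unfolding U by blast
    then show ?thesis using bs q(3) by (auto simp: blk_index nth_eq_iff_index_eq)
  qed
  have blocks: "length b = m \<and> distinct b \<and> set b \<subseteq> E i" if "b \<in> P i" for b
    using part[of i] that by (auto simp: partition_blocks_def)
  have disj: "set b \<inter> set b' = {}" if "b \<in> P i" "b' \<in> P i" "b \<noteq> b'" for b b'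
    using part[of i] that by (auto simp: partition_blocks_def)
  \<comment> \<open>The output blocks, the first \<open>n\<close> rows of column \<open>L\<close>,
    are chosen before any outcome is known.\<close>
  define bs' where "bs' = map (\<lambda>k. blk (k, L)) [0..<n]"
  have in_U: "(k, L) \<in> U" if "k < n" for k using that d by (auto simp: U_def)
  have "k = l" if "k < n" "l < n" "blk (k, L) = blk (l, L)" for k l
    using blk_inj[OF in_U[OF that(1)] in_U[OF that(2)]] that(3) by auto
  then have bs': "length bs' = n" "distinct bs'" "set bs' \<subseteq> P i"
    using block in_U by (auto simp: bs'_def distinct_map inj_on_def)
  define R where "R w \<longleftrightarrow> (\<exists>ps c. (\<forall>k<n. ps k \<in> paulis) \<and>
       w = (\<lambda>S. c * encode m zL oL (E i) bs' (apply_ops ps n phi) S))" for w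
  define Q where "Q V v \<longleftrightarrow> (\<forall>c. steerable (E i) R (\<lambda>S. c * enc m zL oL blk V v S))" for V v
  have final: "Q ({..<n} \<times> {L}) v" if AB: "A \<subseteq> {..<n}" "B \<subseteq> {..<n}"
    and v: "\<And>x. x \<subseteq> {..<n} \<Longrightarrow> v (x \<times> {L}) = c * W A B phi x" for v c A B
    unfolding Q_def
  proof (intro allI steerable_stop)
    fix c'
    obtain c2 where c2: "c2 \<noteq> 0" "apply_ops (\<lambda>k. pauli (k \<in> A) (k \<in> B)) n phi = (\<lambda>S. c2 * W A B phi S)"
      using apply_ops_pauli[of A B n] AB by (auto simp: Int_absorb2)
    have "encode m zL oL (E i) bs' (\<lambda>x. c * W A B phi x) = enc m zL oL blk ({..<n} \<times> {L}) v"
    proof (rule encode_enc[of "\<lambda>k. (k, L)"])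
      show "bij_betw (\<lambda>k. (k, L)) {..<length bs'} ({..<n} \<times> {L})"
        by (auto simp: bij_betw_def inj_on_def bs')
      show "\<Union> (set ` set bs') \<subseteq> E i" using bs'(3) blocks by blast
      fix x assume "x \<subseteq> {..<length bs'}"
      moreover have "(\<lambda>k. (k, L)) ` x = x \<times> {L}" by auto
      ultimately show "c * W A B phi x = v ((\<lambda>k. (k, L)) ` x)" using v by (simp add: bs')
    qed (simp add: bs'_def)
    then have enc_eq: "enc m zL oL blk ({..<n} \<times> {L}) v S = c * encode m zL oL (E i) bs' (W A B phi) S" for S
      unfolding encode_scale by (metis (no_types))
    have "(\<lambda>S. c' * enc m zL oL blk ({..<n} \<times> {L}) v S) =
      (\<lambda>S. (c' * c / c2) * encode m zL oL (E i) bs' (apply_ops (\<lambda>k. pauli (k \<in> A) (k \<in> B)) n phi) S)"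
      unfolding c2(2) encode_scale enc_eq using c2(1) by (simp add: fun_eq_iff)
    then show "R (\<lambda>S. c' * enc m zL oL blk ({..<n} \<times> {L}) v S)"
      unfolding R_def
      by (intro exI[of _ "\<lambda>k. pauli (k \<in> A) (k \<in> B)"] exI[of _ "c' * c / c2"] conjI)
        (simp_all add: pauli_in_paulis)
  qed
  have "steerable (E i) R (psi i)"
  proof (rule steerable_trans[OF steerable], elim exE conjE)
    fix w ps c
    assume ps: "\<forall>k<d * d. ps k \<in> paulis"
      and w: "w = (\<lambda>S. c * encode m zL oL (E i) bs (apply_ops ps (d * d) cl) S)"
    obtain c1 A B where AB: "A \<subseteq> {..<d * d}" "B \<subseteq> {..<d * d}"
      and c1: "\<And>v. apply_ops ps (d * d) v = (\<lambda>S. c1 * W A B v S)"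
      using apply_ops_paulis[OF ps] by metis
    \<comment> \<open>Amplitudes moved from qubit numbers to grid coordinates; the preimage works
      because \<open>grid_index d\<close> is injective.\<close>
    define v where "v S = c1 * W A B cl (grid_index d -` S)" for S
    have v: "v (grid_index d ` T) = c1 * W A B cl T" for T
      by (simp add: v_def inj_vimage_image_eq inj_grid_index)
    have "encode m zL oL (E i) bs (apply_ops ps (d * d) cl) = enc m zL oL blk U v"
    proof (rule encode_enc[of "grid_index d"])
      show "bij_betw (grid_index d) {..<length bs} U"
        using inj_grid_index grid_index_image by (auto simp: bij_betw_def bs U_def intro: inj_on_subset)
      show "\<Union> (set ` set bs) \<subseteq> E i" using bs(3) blocks by blast
    qed (simp_all add: blk_index c1 v)
    moreover have "logically_steerable Q U v"
      unfolding U_def by (rule L[OF d grid_state_cluster[OF cl AB v]]) (rule final)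
    moreover have "finite U" by (simp add: U_def)
    moreover have "steerable (E i) R (\<lambda>S. c * enc m zL oL blk U v S)"
    proof (rule logically_steerable_imp[OF st])
      show "logically_steerable (\<lambda>V v. \<forall>c. steerable (E i) R (\<lambda>S. c * enc m zL oL blk V v S)) U v"
        using \<open>logically_steerable Q U v\<close> unfolding Q_def[abs_def] .
      show "length (blk k) = m \<and> distinct (blk k) \<and> set (blk k) \<subseteq> E i" if "k \<in> U" for k
        using blocks[OF block[OF that]] .
      show "set (blk k) \<inter> set (blk l) = {}" if "k \<in> U" "l \<in> U" "k \<noteq> l" for k l
        using disj[OF block[OF that(1)] block[OF that(2)] blk_inj[OF that]] .
    qed (simp_all add: U_def)
    ultimately show "steerable (E i) R w" unfolding w by simp
  qed
  with bs' show ?thesis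
    unfolding generated_iff_steerable R_def[abs_def] by (intro exI[of _ i] exI[of _ bs']) simp
qed

theorem theorem12:
  fixes E :: "nat \<Rightarrow> 'q set" and psi :: "nat \<Rightarrow> 'q qvec"
  assumes nested: "\<forall>i. finite (E i) \<and> E i \<subseteq> E (Suc i)"
    and states: "\<forall>i. is_state (E i) (psi i)"
  shows "(\<forall>m zL oL P. consistent_family E m zL oL P \<longrightarrow>
            (encoded_universal E m zL oL P psi \<longleftrightarrow> cluster_generable E m zL oL P psi))
       \<and> ((\<exists>m zL oL P. consistent_family E m zL oL P \<and> encoded_universal E m zL oL P psi)
            \<longleftrightarrow> (\<exists>m zL oL P. consistent_family E m zL oL P \<and> cluster_generable E m zL oL P psi))"
proof -
  have "encoded_universal E m zL oL P psi \<longleftrightarrow> cluster_generable E m zL oL P psi"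
    if "consistent_family E m zL oL P" for m zL oL P
    using universal_imp_cluster cluster_imp_generated[OF that]
    unfolding encoded_universal_def by blast
  then show ?thesis by blast
qed

end
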